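(* Let $u\in\mathcal{L}_s(\mathbb{R}^N)\cap C^{1,1}_{loc}(\mathbb{R}^N)\cap\left(\bigcap_{H>0}C^{0,\alpha}(D_H)\right)$ for some $\alpha\in(0,1]$ be a solution of $$(-\Delta+m^2)^s u(x)=f(u(x)),\qquad |u(x)|\le1,\qquad \text{for all } x\in\mathbb{R}^N,$$ with $$u(x',x_N)\to\pm1\ \text{ as } x_N\to\pm\infty,\ \text{ uniformly with respect to } x'=(x_1,\dots,x_{N-1}).$$ Assume that $f$ is continuous in $[-1,1]$ and that there exists $\delta>0$ such that $$\sup\frac{f(t_2)-f(t_1)}{t_2-t_1}<m^{2s},$$ where the supremum is over all pairs $(t_1,t_2)$ with either $-1\le t_1<t_2\le-1+\delta$ or $1-\delta\le t_1<t_2\le1$. Then $u(x)$ is strictly increasing with respect to $x_N$. Furthermore, $u(x)$ depends on $x_N$ only.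
   Context: Let $N\ge 1$ be an integer, $0<s<1$, $m>0$. Points are written $x=(x',x_N)$ with $x'\in\mathbb{R}^{N-1}$. For $H>0$, $D_H:=\mathbb{R}^{N-1}\times[-H,H]$, and $u\in C^{0,\alpha}(D_H)$ means that there is a constant $C_H$ with $\|u\|_{C^{0,\alpha}(D_H)}\le C_H$ (the full Hölder norm on $D_H$ is finite). $K_\nu$ is the modified Bessel function of the second kind of order $\nu$, $K_\nu(r)=\int_0^\infty e^{-r\cosh t}\cosh(\nu t)\,dt$ for $r>0$. The operator $(-\Delta+m^2)^s$ is defined by $$(-\Delta+m^2)^s u(x)=c_{N,s}m^{\frac N2+s}\,\mathrm{P.V.}\int_{\mathbb{R}^N}\frac{u(x)-u(y)}{|x-y|^{\frac N2+s}}K_{\frac N2+s}(m|x-y|)\,dy+m^{2s}u(x),\qquad c_{N,s}=2^{1-\frac N2+s}\pi^{-\frac N2}\frac{s(1-s)}{\Gamma(2-s)},$$ where P.V. denotes the Cauchy principal value. The function space is $\mathcal{L}_s(\mathbb{R}^N)=\{u:\mathbb{R}^N\to\mathbb{R}\,:\,\int_{\mathbb{R}^N}\frac{e^{-|x|}|u(x)|}{1+|x|^{\frac{N+1}2+s}}dx<\infty\}$. $C^{1,1}_{loc}$ denotes $C^1$ functions with locally Lipschitz gradient. *)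

theory Defs
  imports "HOL-Analysis.Analysis"
begin

text \<open>
  \<open>\<real>\<^sup>N\<close> is \<open>real ^ 'n\<close> with \<open>N = CARD('n)\<close>. The coordinate \<open>x\<^sub>N\<close> is \<open>x $ k\<close> for a distinguished
  index \<open>k\<close>; points \<open>x' \<in> \<real>\<^sup>N\<^sup>-\<^sup>1\<close> are identified with the points of the hyperplane \<open>x $ k = 0\<close>,
  so that \<open>(x', t)\<close> is \<open>x' + t *\<^sub>R axis k 1\<close>. This covers \<open>N = 1\<close> as well.
\<close>

definition bessel_K :: "real \<Rightarrow> real \<Rightarrow> real" where
  "bessel_K \<nu> r = (LINT t:{0..}|lborel. exp (- r * cosh t) * cosh (\<nu> * t))"

definition c_const :: "real \<Rightarrow> real \<Rightarrow> real" where
  "c_const N s = 2 powr (1 - N / 2 + s) * pi powr (- N / 2) * (s * (1 - s) / Gamma (2 - s))"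

text \<open>
  Principal value at the point \<open>x\<close>: the truncated integrals exist and converge to \<open>I\<close>
  (so a divergent principal value is never assigned a value).
\<close>

definition has_pv_integral :: "(real ^ 'n \<Rightarrow> real) \<Rightarrow> real \<Rightarrow> real ^ 'n \<Rightarrow> bool" where
  "has_pv_integral F I x \<longleftrightarrow>
     (\<forall>\<epsilon>>0. set_integrable lebesgue (- ball x \<epsilon>) F) \<and>
     ((\<lambda>\<epsilon>. LINT y:(- ball x \<epsilon>)|lebesgue. F y) \<longlongrightarrow> I) (at_right 0)"

text \<open>\<open>has_rel_laplacian m s u L x\<close>: \<open>(-\<Delta> + m\<^sup>2)\<^sup>s u\<close> is defined at \<open>x\<close> and has the value \<open>L\<close> there.\<close>

definition has_rel_laplacian ::
  "real \<Rightarrow> real \<Rightarrow> (real ^ 'n \<Rightarrow> real) \<Rightarrow> real \<Rightarrow> real ^ 'n \<Rightarrow> bool" where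
  "has_rel_laplacian m s u L x \<longleftrightarrow>
     (let N = real CARD('n) in
      \<exists>I. has_pv_integral
             (\<lambda>y. (u x - u y) / norm (x - y) powr (N / 2 + s)
                    * bessel_K (N / 2 + s) (m * norm (x - y))) I x \<and>
          L = c_const N s * m powr (N / 2 + s) * I + m powr (2 * s) * u x)"

definition L_space :: "real \<Rightarrow> (real ^ 'n \<Rightarrow> real) set" where
  "L_space s = {u. u \<in> borel_measurable lebesgue \<and>
     integrable lebesgue
       (\<lambda>x. exp (- norm x) * \<bar>u x\<bar> / (1 + norm x powr ((real CARD('n) + 1) / 2 + s)))}"

definition C11_loc :: "(real ^ 'n \<Rightarrow> real) set" where
  "C11_loc = {u. \<exists>g. (\<forall>x. GDERIV u x :> g x) \<and> continuous_on UNIV g \<and>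
     (\<forall>x. \<exists>r>0. \<exists>L. L-lipschitz_on (ball x r) g)}"

definition holder_norm :: "real \<Rightarrow> (real ^ 'n) set \<Rightarrow> (real ^ 'n \<Rightarrow> real) \<Rightarrow> ennreal" where
  "holder_norm \<alpha> S u =
     (SUP x\<in>S. ennreal \<bar>u x\<bar>) +
     (SUP (x, y)\<in>{(x, y). x \<in> S \<and> y \<in> S \<and> x \<noteq> y}. ennreal (\<bar>u x - u y\<bar> / dist x y powr \<alpha>))"

definition holder_space :: "real \<Rightarrow> (real ^ 'n) set \<Rightarrow> (real ^ 'n \<Rightarrow> real) set" where
  "holder_space \<alpha> S = {u. \<exists>C. holder_norm \<alpha> S u \<le> ennreal C}"

definition slab :: "'n \<Rightarrow> real \<Rightarrow> (real ^ 'n) set" where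
  "slab k H = {x. x $ k \<in> {- H..H}}"

end

theory Submission imports Defs begin

text \<open>
  The proof is a sliding argument. For a vector \<open>v\<close> let \<open>w(x) = u(x + v) - u(x)\<close>. It suffices to show
  \<open>w \<ge> 0\<close> whenever \<open>v\<close> has positive last coordinate: strictness then comes from the strong form of the
  same principle, and letting the last coordinate of \<open>v\<close> tend to \<open>0\<close> gives \<open>u(x) \<le> u(x + v)\<close> for every
  horizontal \<open>v\<close>; applied to \<open>v\<close> and \<open>- v\<close> this says that \<open>u\<close> is constant on horizontal hyperplanes.

  The argument uses four properties of the Bessel kernel: it is even, it is nonnegative, it has a finite second
  moment, and it is bounded below by a positive constant on every punctured ball. They are collected in
  the locale \<open>levy_kernel\<close>. The second moment controls the operator on paraboloids, and this takes
  the place of extracting limits of translates of \<open>u\<close>. If \<open>w\<close> almost attains its infimum \<open>a\<close> at \<open>x\<^sub>0\<close>, then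
  \<open>w + \<epsilon> |\<cdot> - x\<^sub>0|\<^sup>2\<close> has an exact minimum at some \<open>x\<close> near \<open>x\<^sub>0\<close>. There the
  integral operator is at most \<open>O(\<epsilon>)\<close> minus a positive multiple of the mass of \<open>w - a\<close> on an
  annulus around \<open>x\<close> (lemma \<open>touching_paraboloid\<close>). Two consequences carry the theorem.

  Maximum principle (\<open>maximum_principle\<close>): if \<open>w < 0\<close> occurs only where \<open>u(x)\<close> and \<open>u(x + v)\<close> lie both
  near \<open>1\<close> or both near \<open>- 1\<close>, then the slope condition on \<open>f\<close> makes the operator at such almost minima
  bounded below by a positive constant, a contradiction; so \<open>w \<ge> 0\<close>.

  Strict positivity (\<open>strict_positivity_on_slab\<close>): if \<open>w \<ge> 0\<close> and \<open>v\<close> has positive last coordinate,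
  then \<open>w\<close> is bounded below by a positive constant on each slab. Where \<open>w\<close> is almost \<open>0\<close>, the equation
  makes the operator almost \<open>0\<close>, so \<open>w\<close> has small mass nearby. But the increments of \<open>u\<close> along the
  translates by multiples of \<open>v\<close> telescope to a transition from near \<open>- 1\<close> to near \<open>1\<close>, so their
  total mass is bounded below (\<open>increment_mass_lower_bound\<close>).

  For large \<open>t\<close> the maximum principle applies to \<open>t v\<close>. If \<open>t\<^sub>0 > 0\<close> were the infimum of the
  good \<open>t\<close>, strict positivity and the uniform continuity of \<open>u\<close> on slabs would keep \<open>w > 0\<close> on the
  central slab for \<open>t\<close> slightly below \<open>t\<^sub>0\<close>, and the maximum principle would apply again.
\<close>

section \<open>The modified Bessel function of the second kind\<close>

text \<open>
  Exponential decay beats every power. With the free exponent \<open>p\<close> this single elementary estimate gives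
  both the behaviour of the Bessel function at the origin and its decay at infinity.
\<close>

lemma exp_minus_le_powr:
  fixes x p :: real
  assumes "x > 0" "p > 0"
  shows "exp (- x) \<le> (p / x) powr p"
proof -
  have "x / p \<le> exp (x / p)" using exp_ge_add_one_self[of "x / p"] by linarith
  then have "(x / p) powr p \<le> exp (x / p) powr p" using assms by (intro powr_mono2) auto
  also have "\<dots> = exp x" using assms by (simp add: powr_def)
  finally have "inverse (exp x) \<le> inverse ((x / p) powr p)"
    using assms by (intro le_imp_inverse_le) auto
  then show ?thesis using assms by (simp add: exp_minus powr_divide)
qed

lemma cosh_le_exp_abs: "cosh (x::real) \<le> exp \<bar>x\<bar>"
  by (auto simp: cosh_field_def abs_if)

text \<open>
  Bound \<open>cosh t\<close> below by \<open>exp t / 2\<close> and replace the double exponential by the power \<open>- p\<close> of its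
  argument; the excess \<open>p - \<nu>\<close> over the growth rate of \<open>cosh (\<nu> t)\<close> leaves an integrable exponential.
\<close>

lemma bessel_integrand_le:
  fixes \<nu> r p t :: real
  assumes "0 \<le> \<nu>" "\<nu> < p" "0 < r" "0 \<le> t"
  shows "exp (- r * cosh t) * cosh (\<nu> * t) \<le> (2 * p / r) powr p * exp (- (p - \<nu>) * t)"
proof -
  have "exp t / 2 \<le> cosh t" by (simp add: cosh_field_def)
  then have "exp (- r * cosh t) \<le> exp (- (r * exp t / 2))"
    using assms by simp
  also have "\<dots> \<le> (p / (r * exp t / 2)) powr p" using assms by (intro exp_minus_le_powr) auto
  also have "p / (r * exp t / 2) = (2 * p / r) * exp (- t)"
    by (simp add: exp_minus field_simps)
  also have "\<dots> powr p = (2 * p / r) powr p * exp (- p * t)"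
    using assms by (subst powr_mult) (auto simp: powr_def[of "exp (- t)"])
  finally have 1: "exp (- r * cosh t) \<le> (2 * p / r) powr p * exp (- p * t)" .
  have 2: "cosh (\<nu> * t) \<le> exp (\<nu> * t)"
    using cosh_le_exp_abs[of "\<nu> * t"] assms by simp
  have "exp (- r * cosh t) * cosh (\<nu> * t) \<le> ((2 * p / r) powr p * exp (- p * t)) * exp (\<nu> * t)"
    by (intro mult_mono 1 2) auto
  also have "\<dots> = (2 * p / r) powr p * exp (- (p - \<nu>) * t)"
    by (simp add: mult.assoc exp_add[symmetric] algebra_simps)
  finally show ?thesis .
qed

lemma has_bochner_integral_exp_decay:
  fixes c :: real
  assumes "c > 0"
  shows "has_bochner_integral lborel (\<lambda>t. indicator {0..} t * exp (- c * t)) (1 / c)"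
proof (rule has_bochner_integral_nn_integral)
  have *: "((\<lambda>t. - exp (- c * t) / c) \<longlongrightarrow> 0) at_top"
  proof -
    have "filterlim (\<lambda>t. c * t) at_top at_top"
      using assms filterlim_tendsto_pos_mult_at_top[OF tendsto_const _ filterlim_ident] by blast
    then have "((\<lambda>t. exp (- (c * t))) \<longlongrightarrow> 0) at_top"
      by (intro filterlim_compose[OF exp_at_bot]) (simp add: filterlim_uminus_at_bot)
    then have "((\<lambda>t. - exp (- (c * t)) / c) \<longlongrightarrow> - 0 / c) at_top"
      using assms by (intro tendsto_intros) auto
    then show ?thesis by simp
  qed
  have "(\<integral>\<^sup>+t. ennreal (exp (- c * t)) * indicator {0..} t \<partial>lborel) = ennreal (0 - (- exp (- c * 0) / c))"
    using assms
    by (intro nn_integral_FTC_atLeast[where F="\<lambda>t. - exp (- c * t) / c"] *) (auto intro!: derivative_eq_intros)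
  also have "(\<integral>\<^sup>+t. ennreal (exp (- c * t)) * indicator {0..} t \<partial>lborel)
      = (\<integral>\<^sup>+t. ennreal (indicator {0..} t * exp (- c * t)) \<partial>lborel)"
    by (intro nn_integral_cong) (auto simp: indicator_def)
  finally show "(\<integral>\<^sup>+t. ennreal (indicator {0..} t * exp (- c * t)) \<partial>lborel) = ennreal (1 / c)" by simp
qed (use assms in auto)

lemma cosh_measurable [measurable]: "cosh \<in> borel_measurable (borel :: real measure)"
  by (intro borel_measurable_continuous_onI continuous_intros)

lemma integrable_bessel_integrand:
  fixes \<nu> r :: real
  assumes "0 \<le> \<nu>" "0 < r"
  shows "integrable lborel (\<lambda>t. indicator {0..} t * (exp (- r * cosh t) * cosh (\<nu> * t)))"
proof (rule Bochner_Integration.integrable_bound)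
  show "integrable lborel (\<lambda>t. (2 * (\<nu> + 1) / r) powr (\<nu> + 1) * (indicator {0..} t * exp (- 1 * t)))"
    using has_bochner_integral_exp_decay[of 1] by (intro integrable_mult_right) (auto simp: has_bochner_integral_iff)
  show "AE t in lborel. norm (indicator {0..} t * (exp (- r * cosh t) * cosh (\<nu> * t)))
     \<le> norm ((2 * (\<nu> + 1) / r) powr (\<nu> + 1) * (indicator {0..} t * exp (- 1 * t)))"
    using bessel_integrand_le[of \<nu> "\<nu> + 1" r] assms
    by (intro AE_I2) (auto simp: indicator_def abs_mult cosh_real_nonneg)
qed auto

lemma bessel_K_alt:
  "bessel_K \<nu> r = (\<integral>t. indicator {0..} t * (exp (- r * cosh t) * cosh (\<nu> * t)) \<partial>lborel)"
  by (simp add: bessel_K_def set_lebesgue_integral_def)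

text \<open>
  For \<open>p\<close> slightly above \<open>\<nu>\<close> this is almost the sharp singularity \<open>r\<close> to the power \<open>- \<nu>\<close>; for large
  \<open>p\<close> it replaces exponential decay at infinity.
\<close>

lemma bessel_K_le:
  assumes "0 \<le> \<nu>" "\<nu> < p" "0 < r"
  shows "bessel_K \<nu> r \<le> (2 * p / r) powr p / (p - \<nu>)"
proof -
  have I: "has_bochner_integral lborel (\<lambda>t. (2 * p / r) powr p * (indicator {0..} t * exp (- (p - \<nu>) * t)))
      ((2 * p / r) powr p * (1 / (p - \<nu>)))"
    using assms by (intro has_bochner_integral_mult_right has_bochner_integral_exp_decay) auto
  have "bessel_K \<nu> r \<le> (\<integral>t. (2 * p / r) powr p * (indicator {0..} t * exp (- (p - \<nu>) * t)) \<partial>lborel)"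
    unfolding bessel_K_alt using I integrable_bessel_integrand[of \<nu> r] bessel_integrand_le[of \<nu> p r] assms
    by (intro integral_mono) (auto simp: indicator_def has_bochner_integral_iff)
  also have "\<dots> = (2 * p / r) powr p / (p - \<nu>)"
    using has_bochner_integral_integral_eq[OF I] by simp
  finally show ?thesis .
qed

lemma bessel_K_nonneg: "0 \<le> bessel_K \<nu> r"
  unfolding bessel_K_alt by (intro integral_nonneg_AE AE_I2) (auto simp: cosh_real_nonneg)

lemma bessel_K_antimono:
  assumes "0 \<le> \<nu>" "0 < r" "r \<le> r'"
  shows "bessel_K \<nu> r' \<le> bessel_K \<nu> r"
  unfolding bessel_K_alt using assms
  by (intro integral_mono integrable_bessel_integrand)
     (auto simp: indicator_def cosh_real_nonneg intro!: mult_right_mono)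

lemma bessel_K_pos:
  assumes "0 \<le> \<nu>" "0 < r"
  shows "0 < bessel_K \<nu> r"
proof -
  let ?g = "\<lambda>t. indicator {0..} t * (exp (- r * cosh t) * cosh (\<nu> * t)) :: real"
  have "bessel_K \<nu> r \<noteq> 0"
  proof
    assume "bessel_K \<nu> r = 0"
    then have "AE t in lborel. ?g t = 0"
      unfolding bessel_K_alt using assms
      by (subst (asm) integral_nonneg_eq_0_iff_AE)
         (use integrable_bessel_integrand[of \<nu> r] in \<open>auto simp: cosh_real_nonneg\<close>)
    then have "AE t in lborel. t \<notin> {0..(1::real)}"
    proof eventually_elim
      case (elim t)
      have "cosh (\<nu> * t) > 0" by (rule cosh_real_pos)
      then show ?case using elim by (auto simp: indicator_def split: if_splits)
    qed
    then have "emeasure lborel {0..(1::real)} = 0"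
      by (subst (asm) AE_iff_measurable[of "{0..(1::real)}"]) auto
    then show False by simp
  qed
  then show ?thesis using bessel_K_nonneg[of \<nu> r] by linarith
qed

lemma bessel_K_measurable [measurable]: "bessel_K \<nu> \<in> borel_measurable borel"
  unfolding bessel_K_alt[abs_def] by measurable

section \<open>Powers of the norm on Euclidean space\<close>

text \<open>
  A substitute for polar coordinates: \<open>\<bar>g\<bar>\<close> is dominated pointwise by the sum of \<open>a n\<close> times the indicator of
  the ball of radius \<open>R n\<close>, whose integral is, up to the volume of the unit ball, the summable series.
\<close>

lemma integrable_dominated_by_balls:
  fixes g :: "'a::euclidean_space \<Rightarrow> real" and a R :: "nat \<Rightarrow> real"
  assumes [measurable]: "g \<in> borel_measurable borel"
    and nn: "\<And>n. 0 \<le> a n" "\<And>n. 0 \<le> R n"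
    and summable: "summable (\<lambda>n. a n * R n ^ DIM('a))"
    and dom: "\<And>x. g x \<noteq> 0 \<Longrightarrow> \<exists>n. \<bar>g x\<bar> \<le> a n \<and> norm x \<le> R n"
  shows "integrable lborel g"
proof (rule integrableI_bounded)
  let ?v = "unit_ball_vol (real DIM('a))"
  have "(\<integral>\<^sup>+x. ennreal (norm (g x)) \<partial>lborel)
      \<le> (\<integral>\<^sup>+x. (\<Sum>n. ennreal (a n) * indicator (cball (0::'a) (R n)) x) \<partial>lborel)"
  proof (intro nn_integral_mono)
    fix x :: 'a
    show "ennreal (norm (g x)) \<le> (\<Sum>n. ennreal (a n) * indicator (cball 0 (R n)) x)"
    proof (cases "g x = 0")
      case False
      then obtain n where n: "\<bar>g x\<bar> \<le> a n" "norm x \<le> R n" using dom by blast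
      then have "ennreal (norm (g x)) \<le> ennreal (a n) * indicator (cball 0 (R n)) x"
        by (auto simp: indicator_def intro: ennreal_leI)
      also have "\<dots> = (\<Sum>j\<in>{n}. ennreal (a j) * indicator (cball 0 (R j)) x)"
        by (simp only: sum.insert_remove sum.empty finite.emptyI Diff_empty empty_Diff add_0_right)
      also have "\<dots> \<le> (\<Sum>n. ennreal (a n) * indicator (cball 0 (R n)) x)"
        by (intro sum_le_suminf) auto
      finally show ?thesis .
    qed simp
  qed
  also have "\<dots> = (\<Sum>n. ennreal (a n) * emeasure lborel (cball (0::'a) (R n)))"
    by (subst nn_integral_suminf) (auto simp: nn_integral_cmult_indicator intro!: borel_measurable_times_ennreal borel_measurable_indicator)
  also have "\<dots> = (\<Sum>n. ennreal (?v * (a n * R n ^ DIM('a))))"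
    using nn by (intro arg_cong[where f=suminf] ext)
      (simp add: emeasure_cball ennreal_mult[symmetric] mult_ac)
  also have "\<dots> < \<infinity>"
  proof -
    have "(\<Sum>n. ennreal (?v * (a n * R n ^ DIM('a)))) \<noteq> top"
      using summable nn by (intro ennreal_suminf_neq_top summable_mult) auto
    then show ?thesis by (simp add: top.not_eq_extremum)
  qed
  finally show "(\<integral>\<^sup>+x. ennreal (norm (g x)) \<partial>lborel) < \<infinity>" .
qed auto

text \<open>
  On a dyadic shell a power of the norm is constant up to a factor \<open>2 powr \<bar>q\<bar>\<close>, whatever the sign of \<open>q\<close>.
\<close>

lemma powr_le_dyadic:
  fixes x q n :: real
  assumes "x > 0" "\<bar>log 2 x - n\<bar> \<le> 1"
  shows "x powr q \<le> 2 powr (n * q + \<bar>q\<bar>)"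
proof -
  have "x powr q = 2 powr (log 2 x * q)" using assms by (simp flip: powr_powr)
  also have "\<dots> \<le> 2 powr (n * q + \<bar>q\<bar>)"
  proof (rule powr_mono)
    have "(log 2 x - n) * q \<le> \<bar>log 2 x - n\<bar> * \<bar>q\<bar>" by (simp flip: abs_mult)
    also have "\<dots> \<le> 1 * \<bar>q\<bar>" using assms by (intro mult_right_mono) auto
    finally show "log 2 x * q \<le> n * q + \<bar>q\<bar>" by (simp add: algebra_simps)
  qed simp
  finally show ?thesis .
qed

lemma summable_geometric_powr:
  fixes b c :: real
  assumes "b < 0"
  shows "summable (\<lambda>n. c * 2 powr (real n * b))"
proof -
  have "(2::real) powr (real n * b) = (2 powr b) ^ n" for n
    by (simp add: powr_powr[symmetric] powr_realpow mult.commute)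
  moreover have "(2::real) powr b < 1" using assms by (simp add: powr_less_one)
  ultimately show ?thesis by (auto intro!: summable_mult summable_geometric)
qed

lemma integrable_norm_powr_near:
  fixes q :: real
  assumes "- real DIM('a) < q"
  shows "integrable lborel (\<lambda>z::'a::euclidean_space. indicator (ball 0 1) z * norm z powr q)"
proof (rule integrable_dominated_by_balls)
  show "(\<lambda>z::'a. indicator (ball 0 1) z * norm z powr q) \<in> borel_measurable borel"
    by (intro borel_measurable_times borel_measurable_indicator powr_real_measurable) auto
  let ?a = "\<lambda>n. 2 powr (- real n * q + \<bar>q\<bar>)" and ?R = "\<lambda>n. 2 powr (- real n) :: real"
  have "?a n * ?R n ^ DIM('a) = 2 powr \<bar>q\<bar> * 2 powr (real n * (- q - real DIM('a)))" for n
    by (simp add: powr_realpow[symmetric] powr_powr powr_add[symmetric] algebra_simps)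
  then show "summable (\<lambda>n. ?a n * ?R n ^ DIM('a))"
    using assms by (simp only:) (intro summable_geometric_powr, auto)
  fix z :: 'a assume "indicator (ball 0 1) z * norm z powr q \<noteq> 0"
  then have z: "z \<noteq> 0" "norm z < 1" by (auto simp: indicator_def split: if_splits)
  let ?n = "nat \<lfloor>- log 2 (norm z)\<rfloor>"
  have "- log 2 (norm z) \<ge> 0" using z by (simp add: log_le_zero_cancel_iff)
  then have n: "real ?n \<le> - log 2 (norm z)" "- log 2 (norm z) \<le> real ?n + 1" by linarith+
  have "\<bar>log 2 (norm z) - (- real ?n)\<bar> \<le> 1" using n unfolding abs_le_iff by linarith
  then
  have "norm z powr q \<le> ?a ?n" using z by (intro powr_le_dyadic) simp_all
  moreover have "norm z \<le> ?R ?n"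
  proof -
    have "norm z = 2 powr (log 2 (norm z))" using z by simp
    also have "\<dots> \<le> ?R ?n" using n by (intro powr_mono) auto
    finally show ?thesis .
  qed
  ultimately show "\<exists>n. \<bar>indicator (ball 0 1) z * norm z powr q\<bar> \<le> ?a n \<and> norm z \<le> ?R n"
    using z by (intro exI[of _ ?n]) auto
qed auto

lemma integrable_norm_powr_far:
  fixes q :: real
  assumes "q < - real DIM('a)"
  shows "integrable lborel (\<lambda>z::'a::euclidean_space. indicator (- ball 0 1) z * norm z powr q)"
proof (rule integrable_dominated_by_balls)
  show "(\<lambda>z::'a. indicator (- ball 0 1) z * norm z powr q) \<in> borel_measurable borel"
    by (intro borel_measurable_times borel_measurable_indicator powr_real_measurable) auto
  let ?a = "\<lambda>n. 2 powr (real n * q + \<bar>q\<bar>)" and ?R = "\<lambda>n. 2 powr (real n + 1) :: real"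
  have "?a n * ?R n ^ DIM('a) = 2 powr (\<bar>q\<bar> + real DIM('a)) * 2 powr (real n * (q + real DIM('a)))" for n
    by (simp add: powr_realpow[symmetric] powr_powr powr_add[symmetric] algebra_simps)
  then show "summable (\<lambda>n. ?a n * ?R n ^ DIM('a))"
    using assms by (simp only:) (intro summable_geometric_powr, auto)
  fix z :: 'a assume "indicator (- ball 0 1) z * norm z powr q \<noteq> 0"
  then have z: "z \<noteq> 0" "norm z \<ge> 1" by (auto simp: indicator_def split: if_splits)
  let ?n = "nat \<lfloor>log 2 (norm z)\<rfloor>"
  have "log 2 (norm z) \<ge> 0" using z by simp
  then have n: "real ?n \<le> log 2 (norm z)" "log 2 (norm z) \<le> real ?n + 1" by linarith+
  have "\<bar>log 2 (norm z) - real ?n\<bar> \<le> 1" using n unfolding abs_le_iff by linarith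
  then have "norm z powr q \<le> ?a ?n" using z by (intro powr_le_dyadic) simp_all
  moreover have "norm z \<le> ?R ?n"
  proof -
    have "norm z = 2 powr (log 2 (norm z))" using z by simp
    also have "\<dots> \<le> ?R ?n" using n by (intro powr_mono) auto
    finally show ?thesis .
  qed
  ultimately show "\<exists>n. \<bar>indicator (- ball 0 1) z * norm z powr q\<bar> \<le> ?a n \<and> norm z \<le> ?R n"
    using z by (intro exI[of _ ?n]) auto
qed auto

section \<open>Integral operators with a kernel of finite second moment\<close>

lemma integral_lborel_translate:
  fixes f :: "'a::euclidean_space \<Rightarrow> real"
  assumes "f \<in> borel_measurable borel"
  shows "(\<integral>z. f (c + z) \<partial>lborel) = (\<integral>z. f z \<partial>lborel)"
  using integral_distr[of "(+) c" lborel borel f] assms unfolding lborel_distr_plus by simp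

text \<open>
  This is what makes the linear term of a Taylor expansion invisible to a symmetric kernel.
\<close>

lemma integral_lborel_odd:
  fixes f :: "'a::euclidean_space \<Rightarrow> real"
  assumes [measurable]: "f \<in> borel_measurable borel" and odd: "\<And>z. f (- z) = - f z"
  shows "(\<integral>z. f z \<partial>lborel) = 0"
proof -
  have "(lborel :: 'a measure) = distr lborel borel uminus"
    using lborel_affine[of "-1" "0::'a"] by (simp add: density_1)
  then have "(\<integral>z. f z \<partial>lborel) = (\<integral>z. f z \<partial>(distr lborel borel uminus))" by simp
  also have "\<dots> = (\<integral>z. f (- z) \<partial>lborel)" by (intro integral_distr) auto
  also have "\<dots> = - (\<integral>z. f z \<partial>lborel)" by (simp add: odd)
  finally show ?thesis by simp
qed

text \<open>
  The second moment is global, not only near the origin, so that the operator can be applied to a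
  paraboloid on all of space. The lower bound leaves out the origin, where the value of a singular kernel is
  a convention.
\<close>

locale levy_kernel =
  fixes k :: "'a::euclidean_space \<Rightarrow> real"
  assumes kernel_measurable [measurable]: "k \<in> borel_measurable borel"
    and kernel_nonneg: "0 \<le> k z"
    and kernel_even: "k (- z) = k z"
    and kernel_second_moment: "integrable lborel (\<lambda>z. (norm z)\<^sup>2 * k z)"
    and kernel_lower_bound: "0 < R \<Longrightarrow> \<exists>\<kappa>>0. \<forall>z. z \<noteq> 0 \<longrightarrow> norm z \<le> R \<longrightarrow> \<kappa> \<le> k z"
begin

definition second_moment :: real where
  "second_moment = (\<integral>z. (norm z)\<^sup>2 * k z \<partial>lborel)"

text \<open>
  The centre of the integration is moved to the origin: translating \<open>w\<close> then amounts to moving \<open>x\<close>, and the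
  evenness of the kernel can be used directly.
\<close>

definition truncated :: "('a \<Rightarrow> real) \<Rightarrow> 'a \<Rightarrow> real \<Rightarrow> real" where
  "truncated w x \<rho> = (\<integral>z. indicator (- ball 0 \<rho>) z * ((w x - w (x + z)) * k z) \<partial>lborel)"

definition pv :: "('a \<Rightarrow> real) \<Rightarrow> 'a \<Rightarrow> real \<Rightarrow> bool" where
  "pv w x I \<longleftrightarrow> (truncated w x \<longlongrightarrow> I) (at_right 0)"

lemma second_moment_nonneg: "0 \<le> second_moment"
  unfolding second_moment_def by (intro integral_nonneg_AE AE_I2) (simp add: kernel_nonneg)

text \<open>
  Every integrability statement about the truncated operator reduces to this domination: away from the
  origin, constants and linear functions are bounded by multiples of the square of the norm.
\<close>

lemma integrable_second_moment_bound:
  fixes g :: "'a \<Rightarrow> real"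
  assumes "g \<in> borel_measurable borel" "\<And>z. \<bar>g z\<bar> \<le> c * ((norm z)\<^sup>2 * k z)"
  shows "integrable lborel g"
proof (rule Bochner_Integration.integrable_bound)
  show "integrable lborel (\<lambda>z. c * ((norm z)\<^sup>2 * k z))"
    using kernel_second_moment by simp
  show "AE z in lborel. norm (g z) \<le> norm (c * ((norm z)\<^sup>2 * k z))"
    unfolding real_norm_def by (intro AE_I2 order_trans[OF assms(2) abs_ge_self])
qed (use assms in auto)

lemma one_le_norm_sq_div: "0 < \<rho> \<Longrightarrow> \<rho> \<le> norm z \<Longrightarrow> 1 \<le> (norm (z::'a))\<^sup>2 / \<rho>\<^sup>2"
  by (simp add: power_mono)

lemma integrable_truncated:
  assumes [measurable]: "w \<in> borel_measurable borel" and B: "\<And>x. \<bar>w x\<bar> \<le> B" and "0 < \<rho>"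
  shows "integrable lborel (\<lambda>z. indicator (- ball 0 \<rho>) z * ((w x - w (x + z)) * k z))"
proof (rule integrable_second_moment_bound)
  have m: "(\<lambda>z. (w x - w (x + z)) * k z) \<in> borel_measurable borel" by measurable
  show "(\<lambda>z. indicator (- ball 0 \<rho>) z * ((w x - w (x + z)) * k z)) \<in> borel_measurable borel"
    by (intro borel_measurable_times borel_measurable_indicator m) auto
  fix z
  have B0: "0 \<le> B" using B[of x] by linarith
  show "\<bar>indicator (- ball 0 \<rho>) z * ((w x - w (x + z)) * k z)\<bar> \<le> (2 * B / \<rho>\<^sup>2) * ((norm z)\<^sup>2 * k z)"
  proof (cases "z \<in> ball 0 \<rho>")
    case False
    have "\<bar>w x - w (x + z)\<bar> \<le> 2 * B" using B[of x] B[of "x + z"] by linarith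
    also have "\<dots> \<le> 2 * B * ((norm z)\<^sup>2 / \<rho>\<^sup>2)"
      using mult_left_mono[OF one_le_norm_sq_div[of \<rho> z], of "2 * B"] B0 False assms by auto
    finally have "\<bar>w x - w (x + z)\<bar> * k z \<le> 2 * B * ((norm z)\<^sup>2 / \<rho>\<^sup>2) * k z"
      by (intro mult_right_mono kernel_nonneg)
    then show ?thesis using False by (simp add: abs_mult kernel_nonneg)
  qed (use B0 in \<open>simp add: kernel_nonneg\<close>)
qed

lemma pv_increment:
  assumes [measurable]: "u \<in> borel_measurable borel" and B: "\<And>x. \<bar>u x\<bar> \<le> B"
    and I: "pv u (x + v) I" "pv u x J"
  shows "pv (\<lambda>x. u (x + v) - u x) x (I - J)"
  unfolding pv_def
proof (rule Lim_transform_eventually)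
  show "((\<lambda>\<rho>. truncated u (x + v) \<rho> - truncated u x \<rho>) \<longlongrightarrow> I - J) (at_right 0)"
    using I unfolding pv_def by (intro tendsto_diff)
  show "\<forall>\<^sub>F \<rho> in at_right 0. truncated u (x + v) \<rho> - truncated u x \<rho>
      = truncated (\<lambda>x. u (x + v) - u x) x \<rho>"
    using eventually_at_right_less[of 0]
  proof eventually_elim
    case (elim \<rho>)
    note i = integrable_truncated[OF assms(1) B elim]
    show ?case
      unfolding truncated_def Bochner_Integration.integral_diff[OF i[of "x + v"] i[of x], symmetric]
      by (intro Bochner_Integration.integral_cong) (simp_all add: algebra_simps)
  qed
qed

lemma pv_of_has_pv_integral:
  fixes u :: "'a \<Rightarrow> real"
  assumes [measurable]: "u \<in> borel_measurable borel"
    and lim: "((\<lambda>\<epsilon>. LINT y:(- ball x \<epsilon>)|lebesgue. (u x - u y) * k (x - y)) \<longlongrightarrow> I) (at_right 0)"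
  shows "pv u x I"
proof -
  have "(LINT y:(- ball x \<epsilon>)|lebesgue. (u x - u y) * k (x - y)) = truncated u x \<epsilon>" for \<epsilon>
  proof -
    let ?F = "\<lambda>y. indicator (- ball x \<epsilon>) y * ((u x - u y) * k (x - y)) :: real"
    have F0: "(\<lambda>y. (u x - u y) * k (x - y)) \<in> borel_measurable borel" by measurable
    have F: "?F \<in> borel_measurable borel"
      by (intro borel_measurable_times borel_measurable_indicator F0) auto
    have "(LINT y:(- ball x \<epsilon>)|lebesgue. (u x - u y) * k (x - y)) = (\<integral>y. ?F y \<partial>lborel)"
      unfolding set_lebesgue_integral_def using F by (subst integral_completion) simp_all
    also have "\<dots> = (\<integral>z. ?F (x + z) \<partial>lborel)" by (rule integral_lborel_translate[OF F, symmetric])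
    also have "\<dots> = truncated u x \<epsilon>"
      unfolding truncated_def by (intro Bochner_Integration.integral_cong) (auto simp: indicator_def kernel_even dist_norm)
    finally show ?thesis .
  qed
  with lim show ?thesis unfolding pv_def by simp
qed

text \<open>
  The key estimate. The infimum of \<open>w\<close> need not be attained, but the perturbation \<open>h\<close> of \<open>w\<close> by a small
  paraboloid with vertex \<open>x0\<close> attains its minimum within distance \<open>1\<close> of \<open>x0\<close>, because at larger distances
  the paraboloid already exceeds the gap \<open>\<epsilon>\<close>. At the minimum, \<open>w\<close> is touched from below by a paraboloid.
  Its quadratic part contributes at most \<open>\<epsilon>\<close> times the second moment, and its linear part cancels by
  symmetry. On the annulus \<open>r \<le> |z| \<le> R\<close> the touching is not used; there the integrand is bounded by
  \<open>\<epsilon> - (w(x + z) - a)\<close>, which retains the mass of \<open>w - a\<close>.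
\<close>

lemma touching_paraboloid:
  assumes cont: "continuous_on UNIV w" and B: "\<And>x. \<bar>w x\<bar> \<le> B"
    and low: "\<And>x. a \<le> w x" and near: "w x0 \<le> a + \<epsilon>" and "0 < \<epsilon>"
    and pv: "\<And>x. pv w x (I x)"
    and r: "0 < r" and \<kappa>: "0 \<le> \<kappa>" "\<And>z. z \<noteq> 0 \<Longrightarrow> norm z \<le> R \<Longrightarrow> \<kappa> \<le> k z"
  obtains x where "dist x0 x \<le> 1" "w x \<le> w x0"
    "I x \<le> \<epsilon> * (1 + 1 / r\<^sup>2) * second_moment
        - \<kappa> * (\<integral>z. indicator {z. r \<le> norm z \<and> norm z \<le> R} z * (w (x + z) - a) \<partial>lborel)"
proof -
  have [measurable]: "w \<in> borel_measurable borel"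
    using cont by (rule borel_measurable_continuous_onI)
  define A where "A = {z::'a. r \<le> norm z \<and> norm z \<le> R}"
  have A: "A = cball 0 R - ball 0 r" by (auto simp: A_def)
  have Am [measurable]: "A \<in> sets borel" unfolding A by auto
  define h where "h y = w y + \<epsilon> * (norm (y - x0))\<^sup>2" for y
  have "continuous_on (cball x0 1) h"
    unfolding h_def by (intro continuous_intros continuous_on_subset[OF cont]) auto
  then obtain x where x: "x \<in> cball x0 1" "\<And>y. y \<in> cball x0 1 \<Longrightarrow> h x \<le> h y"
    using continuous_attains_inf[of "cball x0 1" h] by auto
  have hx0: "h x \<le> w x0" using x(2)[of x0] by (simp add: h_def)
  have hmin: "h x \<le> h y" for y
  proof (cases "y \<in> cball x0 1")
    case False
    then have "1 \<le> norm (y - x0)" by (simp add: dist_norm norm_minus_commute)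
    then have "\<epsilon> * 1 \<le> \<epsilon> * (norm (y - x0))\<^sup>2" using \<open>0 < \<epsilon>\<close> by (intro mult_left_mono) auto
    then have "a + \<epsilon> \<le> h y" using low[of y] by (simp add: h_def)
    then show ?thesis using hx0 near by linarith
  qed (use x in auto)
  have wx: "w x \<le> w x0" using hx0 \<open>0 < \<epsilon>\<close> by (simp add: h_def) (smt (verit) mult_nonneg_nonneg zero_le_power2)
  have touch: "w x - w (x + z) \<le> \<epsilon> * (norm z)\<^sup>2 + 2 * \<epsilon> * ((x - x0) \<bullet> z)" for z
  proof -
    have "(norm (x + z - x0))\<^sup>2 = (norm (x - x0))\<^sup>2 + (norm z)\<^sup>2 + 2 * ((x - x0) \<bullet> z)"
      by (simp add: power2_norm_eq_inner algebra_simps inner_commute)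
    then have "w x + \<epsilon> * (norm (x - x0))\<^sup>2
        \<le> w (x + z) + \<epsilon> * ((norm (x - x0))\<^sup>2 + (norm z)\<^sup>2 + 2 * ((x - x0) \<bullet> z))"
      using hmin[of "x + z"] by (simp add: h_def)
    then show ?thesis by (simp add: ring_distribs)
  qed
  \<comment> \<open>The region where the touching is used. It is symmetric, so the odd term \<open>q\<close> integrates to \<open>0\<close>.\<close>
  define S where "S \<rho> = - ball 0 \<rho> - A" for \<rho>
  have Sm [measurable]: "S \<rho> \<in> sets borel" for \<rho> unfolding S_def using Am by auto
  define q where "q \<rho> z = indicator (S \<rho>) z * (2 * \<epsilon> * ((x - x0) \<bullet> z) * k z)" for \<rho> z
  have qm: "q \<rho> \<in> borel_measurable borel" for \<rho> unfolding q_def by measurable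
  have q0: "(\<integral>z. q \<rho> z \<partial>lborel) = 0" for \<rho>
    by (rule integral_lborel_odd[OF qm]) (auto simp: q_def S_def A_def kernel_even indicator_def)
  have qi: "integrable lborel (q \<rho>)" if "0 < \<rho>" for \<rho>
  proof (rule integrable_second_moment_bound[OF qm])
    fix z
    let ?b = "2 * \<epsilon> * norm (x - x0)"
    show "\<bar>q \<rho> z\<bar> \<le> ?b / \<rho> * ((norm z)\<^sup>2 * k z)"
    proof (cases "z \<in> S \<rho>")
      case True
      then have "\<rho> \<le> norm z" by (auto simp: S_def)
      then have "?b * norm z * \<rho> \<le> ?b * norm z * norm z"
        using \<open>0 < \<epsilon>\<close> by (intro mult_left_mono) auto
      then have "?b * norm z \<le> ?b / \<rho> * (norm z)\<^sup>2"
        using that by (simp add: field_simps power2_eq_square)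
      moreover have "\<bar>2 * \<epsilon> * ((x - x0) \<bullet> z)\<bar> \<le> ?b * norm z"
        using \<open>0 < \<epsilon>\<close> Cauchy_Schwarz_ineq2[of "x - x0" z] by (simp add: abs_mult)
      ultimately have "\<bar>2 * \<epsilon> * ((x - x0) \<bullet> z)\<bar> * k z \<le> ?b / \<rho> * (norm z)\<^sup>2 * k z"
        by (intro mult_right_mono kernel_nonneg) linarith
      then show ?thesis using True by (simp add: q_def abs_mult kernel_nonneg mult.assoc)
    qed (use \<open>0 < \<epsilon>\<close> that in \<open>simp add: q_def kernel_nonneg\<close>)
  qed
  define c where "c = \<epsilon> * (1 + 1 / r\<^sup>2)"
  let ?g = "\<lambda>z. indicator A z * (w (x + z) - a)"
  have gi: "integrable lborel ?g"
  proof -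
    have 1: "emeasure lborel A < \<infinity>"
      by (intro emeasure_bounded_finite bounded_subset[OF bounded_cball[of 0 R]]) (auto simp: A)
    have "\<bar>w (x + z) - a\<bar> \<le> B + \<bar>a\<bar>" for z using B[of "x + z"] by linarith
    then have 2: "AE z in lborel. z \<in> A \<longrightarrow> norm (w (x + z) - a) \<le> B + \<bar>a\<bar>" by simp
    have "integrable lborel (\<lambda>z. indicator A z *\<^sub>R (w (x + z) - a))"
      by (rule integrableI_bounded_set_indicator[OF _ _ 1 2]) (use Am in auto)
    then show ?thesis by simp
  qed
  have pointwise: "indicator (- ball 0 \<rho>) z * ((w x - w (x + z)) * k z)
      \<le> c * ((norm z)\<^sup>2 * k z) + q \<rho> z - \<kappa> * ?g z" if "0 < \<rho>" "\<rho> < r" for \<rho> z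
  proof -
    have c0: "\<epsilon> \<le> c" "0 \<le> c" using \<open>0 < \<epsilon>\<close> by (auto simp: c_def algebra_simps)
    consider "z \<in> A" | "z \<notin> A" "z \<in> ball 0 \<rho>" | "z \<notin> A" "z \<notin> ball 0 \<rho>" by blast
    then show ?thesis
    proof cases
      case 1
      then have z: "r \<le> norm z" "norm z \<le> R" "z \<noteq> 0" using r by (auto simp: A_def)
      have "\<epsilon> * 1 \<le> \<epsilon> * ((norm z)\<^sup>2 / r\<^sup>2)"
        using \<open>0 < \<epsilon>\<close> one_le_norm_sq_div[OF r z(1)] by (intro mult_left_mono) auto
      also have "\<dots> \<le> c * (norm z)\<^sup>2" using \<open>0 < \<epsilon>\<close> by (simp add: c_def algebra_simps)
      finally have "\<epsilon> * k z \<le> c * (norm z)\<^sup>2 * k z" by (intro mult_right_mono kernel_nonneg) auto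
      moreover have "(w (x + z) - a) * \<kappa> \<le> (w (x + z) - a) * k z"
        using \<kappa>(2)[OF z(3,2)] low by (intro mult_left_mono) auto
      moreover have "(w x - w (x + z)) * k z \<le> (\<epsilon> - (w (x + z) - a)) * k z"
        using wx near by (intro mult_right_mono kernel_nonneg) auto
      moreover have "z \<in> - ball 0 \<rho>" using z that by auto
      ultimately show ?thesis using 1 by (simp add: q_def S_def algebra_simps)
    next
      case 2
      then show ?thesis using c0 by (simp add: q_def S_def kernel_nonneg)
    next
      case 3
      have "\<epsilon> * (norm z)\<^sup>2 \<le> c * (norm z)\<^sup>2" using c0 by (intro mult_right_mono) auto
      then have "(w x - w (x + z)) * k z \<le> (c * (norm z)\<^sup>2 + 2 * \<epsilon> * ((x - x0) \<bullet> z)) * k z"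
        using touch[of z] by (intro mult_right_mono kernel_nonneg) linarith
      then show ?thesis using 3 by (simp add: q_def S_def algebra_simps)
    qed
  qed
  have bound: "truncated w x \<rho> \<le> c * second_moment - \<kappa> * (\<integral>z. ?g z \<partial>lborel)"
    if "0 < \<rho>" "\<rho> < r" for \<rho>
  proof -
    have i: "integrable lborel (\<lambda>z. c * ((norm z)\<^sup>2 * k z))" "integrable lborel (\<lambda>z. \<kappa> * ?g z)"
      using kernel_second_moment gi by auto
    note i' = Bochner_Integration.integrable_add[OF i(1) qi[OF that(1)]]
    have "truncated w x \<rho> \<le> (\<integral>z. c * ((norm z)\<^sup>2 * k z) + q \<rho> z - \<kappa> * ?g z \<partial>lborel)"
      unfolding truncated_def
      by (rule integral_mono[OF integrable_truncated[OF _ B that(1)] Bochner_Integration.integrable_diff[OF i' i(2)]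
            pointwise[OF that]]) simp
    also have "\<dots> = (\<integral>z. c * ((norm z)\<^sup>2 * k z) \<partial>lborel) + (\<integral>z. q \<rho> z \<partial>lborel) - (\<integral>z. \<kappa> * ?g z \<partial>lborel)"
      by (simp only: Bochner_Integration.integral_diff[OF i' i(2)] Bochner_Integration.integral_add[OF i(1) qi[OF that(1)]])
    also have "\<dots> = c * second_moment - \<kappa> * (\<integral>z. ?g z \<partial>lborel)"
      by (simp add: q0 second_moment_def)
    finally show ?thesis .
  qed
  have "I x \<le> c * second_moment - \<kappa> * (\<integral>z. ?g z \<partial>lborel)"
  proof (rule tendsto_upperbound)
    show "(truncated w x \<longlongrightarrow> I x) (at_right 0)" using pv by (simp add: pv_def)
    show "\<forall>\<^sub>F \<rho> in at_right 0. truncated w x \<rho> \<le> c * second_moment - \<kappa> * (\<integral>z. ?g z \<partial>lborel)"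
      using bound r by (auto simp: eventually_at_right_field)
  qed simp
  with x(1) wx show ?thesis by (intro that[of x]) (auto simp: c_def A_def)
qed

end

section \<open>The sliding method\<close>

text \<open>
  The equation is \<open>C\<close> times the principal value plus \<open>\<mu> u\<close>, with \<open>\<mu>\<close> in the role of \<open>m\<close> to the power \<open>2 s\<close>.
  The strict inequality \<open>\<kappa> < \<mu>\<close> with a number \<open>\<kappa>\<close> that bounds all difference quotients of \<open>f\<close> near
  \<open>\<plusminus>1\<close> is what is left of the supremum condition. The direction \<open>e\<close> is that of the last coordinate.
\<close>

locale sliding_problem = levy_kernel k for k :: "'a::euclidean_space \<Rightarrow> real" +
  fixes u :: "'a \<Rightarrow> real" and f :: "real \<Rightarrow> real" and e :: 'a and C \<mu> \<kappa> \<delta> :: real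
  assumes C_pos: "0 < C"
    and u_continuous: "continuous_on UNIV u"
    and u_bounded: "\<bar>u x\<bar> \<le> 1"
    and equation: "\<exists>I. pv u x I \<and> f (u x) = C * I + \<mu> * u x"
    and unit: "e \<bullet> e = 1"
    and u_uniformly_continuous: "uniformly_continuous_on {x. \<bar>x \<bullet> e\<bar> \<le> H} u"
    and u_top: "\<eta> > 0 \<Longrightarrow> \<exists>H. \<forall>x. H \<le> x \<bullet> e \<longrightarrow> 1 - \<eta> < u x"
    and u_bot: "\<eta> > 0 \<Longrightarrow> \<exists>H. \<forall>x. x \<bullet> e \<le> - H \<longrightarrow> u x < - 1 + \<eta>"
    and f_continuous: "continuous_on {-1..1} f"
    and \<delta>_pos: "0 < \<delta>" and \<kappa>_less: "\<kappa> < \<mu>"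
    and f_slope: "t1 < t2 \<Longrightarrow> (- 1 \<le> t1 \<and> t2 \<le> - 1 + \<delta>) \<or> (1 - \<delta> \<le> t1 \<and> t2 \<le> 1) \<Longrightarrow>
        f t2 - f t1 \<le> \<kappa> * (t2 - t1)"
begin

definition incr :: "'a \<Rightarrow> 'a \<Rightarrow> real" where
  "incr v x = u (x + v) - u x"

lemma incr_bounded: "\<bar>incr v x\<bar> \<le> 2"
  using u_bounded[of x] u_bounded[of "x + v"] by (simp add: incr_def)

lemma incr_continuous: "continuous_on UNIV (incr v)"
proof -
  have "continuous_on UNIV (\<lambda>x. u (x + v))"
    by (rule continuous_on_compose2[OF u_continuous]) (auto intro!: continuous_intros)
  then show ?thesis unfolding incr_def by (intro continuous_on_diff u_continuous)
qed

lemma u_measurable [measurable]: "u \<in> borel_measurable borel"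
  using u_continuous by (rule borel_measurable_continuous_onI)

lemma incr_measurable [measurable]: "incr v \<in> borel_measurable borel"
  using incr_continuous by (rule borel_measurable_continuous_onI)

text \<open>
  The value that subtracting the equations at \<open>x + v\<close> and \<open>x\<close> forces on the principal value of the increment.
\<close>

definition incr_pv :: "'a \<Rightarrow> 'a \<Rightarrow> real" where
  "incr_pv v x = (f (u (x + v)) - f (u x) - \<mu> * incr v x) / C"

lemma pv_incr: "pv (incr v) x (incr_pv v x)"
proof -
  obtain I where I: "pv u (x + v) I" "f (u (x + v)) = C * I + \<mu> * u (x + v)"
    using equation by blast
  obtain J where J: "pv u x J" "f (u x) = C * J + \<mu> * u x"
    using equation by blast
  have "I - J = incr_pv v x"
    using I(2) J(2) C_pos by (simp add: incr_pv_def incr_def field_simps)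
  then show ?thesis
    using pv_increment[OF u_measurable u_bounded I(1) J(1)] by (simp add: incr_def[abs_def])
qed

lemma C_times_incr_pv: "C * incr_pv v x = f (u (x + v)) - f (u x) - \<mu> * incr v x"
  using C_pos by (simp add: incr_pv_def)

lemma touching_increment:
  assumes "\<And>x. a \<le> incr v x" and "incr v x0 \<le> a + \<epsilon>" and "0 < \<epsilon>"
    and "0 < r" and "0 \<le> c" "\<And>z. z \<noteq> 0 \<Longrightarrow> norm z \<le> R \<Longrightarrow> c \<le> k z"
  obtains x where "dist x0 x \<le> 1" "incr v x \<le> incr v x0"
    "incr_pv v x \<le> \<epsilon> * (1 + 1 / r\<^sup>2) * second_moment
        - c * (\<integral>z. indicator {z. r \<le> norm z \<and> norm z \<le> R} z * (incr v (x + z) - a) \<partial>lborel)"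
proof (rule touching_paraboloid[where R=R, OF incr_continuous incr_bounded assms(1-3) pv_incr assms(4,5)])
  show "c \<le> k z" if "z \<noteq> 0" "norm z \<le> R" for z using that by (rule assms(6))
qed (rule that)

text \<open>
  At an almost minimum of a negative increment, the equation and the slope condition bound the operator
  below by \<open>(\<mu> - \<kappa>) / C\<close> times the size of the increment, while \<open>touching_increment\<close> bounds it above by
  a multiple of \<open>\<epsilon>\<close>.
\<close>

lemma maximum_principle:
  assumes slope: "\<And>x. incr v x < 0 \<Longrightarrow> \<kappa> * incr v x \<le> f (u (x + v)) - f (u x)"
  shows "0 \<le> incr v x"
proof (rule ccontr)
  assume neg: "\<not> 0 \<le> incr v x"
  define a where "a = (INF y. incr v y)"
  have bdd: "bdd_below (range (incr v))"
    using incr_bounded[of v] by (intro bdd_belowI2[of _ "-2"]) (simp add: abs_le_iff minus_le_iff)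
  have low: "a \<le> incr v y" for y unfolding a_def by (intro cINF_lower bdd) simp
  have "a < 0" using low[of x] neg by linarith
  define s where "s = (\<mu> - \<kappa>) * (- a)"
  have s: "0 < s" using \<open>a < 0\<close> \<kappa>_less by (auto simp: s_def intro!: mult_pos_neg)
  \<comment> \<open>The first bound keeps the increment below \<open>a / 2\<close>; the second keeps the upper bound of \<open>C\<close> times the operator below \<open>s / 2\<close>.\<close>
  define \<epsilon> where "\<epsilon> = min (- a / 2) (s / (8 * C * (second_moment + 1)))"
  have \<epsilon>: "0 < \<epsilon>" "\<epsilon> \<le> - a / 2" using s C_pos second_moment_nonneg \<open>a < 0\<close> by (auto simp: \<epsilon>_def)
  have "\<epsilon> * (8 * C * (second_moment + 1)) \<le> s"
    using C_pos second_moment_nonneg by (simp add: \<epsilon>_def pos_le_divide_eq[symmetric])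
  then have \<epsilon>2: "8 * (C * (\<epsilon> * second_moment)) \<le> s"
  proof -
    have "\<epsilon> * (8 * C * (second_moment + 1)) = 8 * (C * (\<epsilon> * second_moment)) + 8 * (C * \<epsilon>)"
      by (simp add: algebra_simps)
    moreover have "0 < C * \<epsilon>" using C_pos \<epsilon> by simp
    ultimately show ?thesis using \<open>\<epsilon> * (8 * C * (second_moment + 1)) \<le> s\<close> by linarith
  qed
  obtain x0 where x0: "incr v x0 < a + \<epsilon>"
    using cINF_less_iff[of UNIV "incr v" "a + \<epsilon>"] bdd \<epsilon> by (auto simp: a_def)
  obtain y where y: "incr v y \<le> incr v x0" "incr_pv v y \<le> \<epsilon> * (1 + 1 / 1\<^sup>2) * second_moment"
    using touching_increment[of a v x0 \<epsilon> 1 0 0] low x0 \<epsilon> by (auto simp: kernel_nonneg)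
  have wy: "incr v y \<le> a / 2" using y x0 \<epsilon> by linarith
  then have "\<kappa> * incr v y \<le> f (u (y + v)) - f (u y)" using slope \<open>a < 0\<close> by auto
  then have "(\<mu> - \<kappa>) * (- incr v y) \<le> C * incr_pv v y"
    unfolding C_times_incr_pv by (simp add: algebra_simps)
  moreover have "(\<mu> - \<kappa>) * (- a / 2) \<le> (\<mu> - \<kappa>) * (- incr v y)"
    using wy \<kappa>_less by (intro mult_left_mono) auto
  moreover have "C * incr_pv v y \<le> C * (\<epsilon> * (1 + 1 / 1\<^sup>2) * second_moment)"
    using y C_pos by (intro mult_left_mono) auto
  moreover have "C * (\<epsilon> * (1 + 1 / 1\<^sup>2) * second_moment) = 2 * (C * (\<epsilon> * second_moment))" by simp
  moreover have "(\<mu> - \<kappa>) * (- a / 2) = s / 2" by (simp add: s_def)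
  ultimately have "s / 2 \<le> 2 * (C * (\<epsilon> * second_moment))" by linarith
  with \<epsilon>2 s show False by linarith
qed

text \<open>
  Outside a central slab \<open>u\<close> is within \<open>\<delta>\<close> of \<open>\<plusminus>1\<close>. If \<open>u(x + v) < u(x)\<close> and \<open>x\<close> lies below the slab,
  then \<open>u(x + v)\<close> is also near \<open>- 1\<close>; if \<open>x + v\<close> lies above the slab, then \<open>u(x)\<close> is also near \<open>1\<close>. In
  both cases the slope condition applies.
\<close>

lemma ordering_outside_core:
  obtains H where "0 \<le> H"
    "\<And>v x. \<forall>x. incr v x < 0 \<longrightarrow> x \<bullet> e \<le> - H \<or> H \<le> (x + v) \<bullet> e \<Longrightarrow> 0 \<le> incr v x"
proof -
  obtain H1 where H1: "\<And>x. H1 \<le> x \<bullet> e \<Longrightarrow> 1 - \<delta> < u x" using u_top[OF \<delta>_pos] by blast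
  obtain H2 where H2: "\<And>x. x \<bullet> e \<le> - H2 \<Longrightarrow> u x < - 1 + \<delta>" using u_bot[OF \<delta>_pos] by blast
  define H where "H = max 0 (max H1 H2)"
  have H: "0 \<le> H" "H1 \<le> H" "H2 \<le> H" by (auto simp: H_def)
  show ?thesis
  proof (rule that[OF H(1)])
    fix v x
    assume dich: "\<forall>x. incr v x < 0 \<longrightarrow> x \<bullet> e \<le> - H \<or> H \<le> (x + v) \<bullet> e"
    show "0 \<le> incr v x"
    proof (rule maximum_principle)
      fix x assume neg: "incr v x < 0"
      then have lt: "u (x + v) < u x" by (simp add: incr_def)
      have "u x \<le> - 1 + \<delta> \<or> 1 - \<delta> \<le> u (x + v)"
        using dich neg H1[of "x + v"] H2[of x] H by fastforce
      then have "f (u x) - f (u (x + v)) \<le> \<kappa> * (u x - u (x + v))"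
        using f_slope[OF lt] u_bounded[of x] u_bounded[of "x + v"] by (auto simp: abs_le_iff)
      then show "\<kappa> * incr v x \<le> f (u (x + v)) - f (u x)"
        by (simp add: incr_def algebra_simps)
    qed
  qed
qed

text \<open>
  The increments of \<open>u\<close> at the points \<open>x + s\<^sub>i v + z\<close> telescope to a difference between values of \<open>u\<close> far
  above and far below, which is at least \<open>1\<close>. Integrating over \<open>z\<close> in a small ball, and using that each
  translated ball lies in the annulus, bounds the mass below uniformly in \<open>x\<close>.
\<close>

lemma increment_mass_lower_bound:
  assumes v: "0 < v \<bullet> e" and nonneg: "\<And>x. 0 \<le> incr v x"
  obtains R \<beta> where "0 < R" "0 < \<beta>"
    "\<And>x. \<bar>x \<bullet> e\<bar> \<le> H \<Longrightarrow>
      \<beta> \<le> (\<integral>z. indicator {z. norm v / 4 \<le> norm z \<and> norm z \<le> R} z * incr v (x + z) \<partial>lborel)"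
proof -
  obtain H1 where H1: "\<And>x. H1 \<le> x \<bullet> e \<Longrightarrow> 1 - 1 / 2 < u x" using u_top[of "1/2"] by force
  obtain H2 where H2: "\<And>x. x \<bullet> e \<le> - H2 \<Longrightarrow> u x < - 1 + 1 / 2" using u_bot[of "1/2"] by force
  have v0: "v \<noteq> 0" using v by auto
  have ne: "norm e = 1" using unit by (simp add: norm_eq_sqrt_inner)
  define r where "r = norm v / 4"
  have r: "0 < r" using v0 by (simp add: r_def)
  \<comment> \<open>\<open>J\<close> steps of length \<open>v\<close> lead from every point used below to the regions \<open>u > 1 / 2\<close> and \<open>u < - 1 / 2\<close>.\<close>
  define L where "L = \<bar>H\<bar> + norm v + \<bar>H1\<bar> + \<bar>H2\<bar>"
  obtain J :: nat where J: "L / (v \<bullet> e) < real J" using reals_Archimedean2 by blast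
  then have J': "L < real J * (v \<bullet> e)" using v by (simp add: pos_divide_less_eq)
  have "0 < L" using v0 by (simp add: L_def add_nonneg_pos add_pos_nonneg)
  then have "0 < real J" using J divide_pos_pos[OF \<open>0 < L\<close> v] by linarith
  define R where "R = norm v * (real J + 1)"
  \<comment> \<open>Half-integer multiples of \<open>v\<close> stay at distance at least \<open>norm v / 2 = 2 * r\<close> from the origin, so the balls of radius \<open>r\<close> avoid the hole of the annulus.\<close>
  define s where "s i = real i - real J + 1 / 2" for i :: nat
  define A where "A = {z::'a. r \<le> norm z \<and> norm z \<le> R}"
  have A: "A = cball 0 R - ball 0 r" by (auto simp: A_def)
  have Am [measurable]: "A \<in> sets borel" unfolding A by auto
  have int: "integrable lborel (\<lambda>z. indicator D z * incr v (x + z))" if "bounded D" "D \<in> sets borel" for D x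
  proof -
    have "integrable lborel (\<lambda>z. indicator D z *\<^sub>R incr v (x + z))"
      using that incr_bounded
      by (intro integrableI_bounded_set_indicator[where B=2] emeasure_bounded_finite) auto
    then show ?thesis by simp
  qed
  have bA: "bounded A" unfolding A by (intro bounded_diff bounded_cball)
  have ball_sub: "indicator (ball (s i *\<^sub>R v) r) z \<le> (indicator A z :: real)" if "i < 2 * J" for i z
  proof (cases "z \<in> ball (s i *\<^sub>R v) r")
    case True
    have s: "1 / 2 \<le> \<bar>s i\<bar>" "\<bar>s i\<bar> \<le> real J"
    proof -
      have "real i \<le> 2 * real J - 1" using that by linarith
      moreover have "real i - real J \<le> - 1 \<or> 0 \<le> real i - real J"
      proof (cases "J \<le> i")
        case False
        then have "real (i + 1) \<le> real J" by (intro of_nat_mono) simp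
        then show ?thesis by simp
      qed simp
      ultimately show "1 / 2 \<le> \<bar>s i\<bar>" "\<bar>s i\<bar> \<le> real J" by (auto simp: s_def abs_if)
    qed
    have d: "norm (s i *\<^sub>R v - z) < r" using True by (simp add: dist_norm)
    have "1 / 2 * norm v \<le> norm (s i *\<^sub>R v)" "norm (s i *\<^sub>R v) \<le> real J * norm v"
      using s[THEN mult_right_mono, OF norm_ge_zero[of v]] by simp_all
    moreover have "norm (s i *\<^sub>R v) \<le> norm z + norm (s i *\<^sub>R v - z)" by (rule norm_triangle_sub)
    moreover have "norm z \<le> norm (s i *\<^sub>R v) + norm (s i *\<^sub>R v - z)"
      using norm_triangle_sub[of z "s i *\<^sub>R v"] by (simp add: norm_minus_commute)
    moreover have "norm v * (real J + 1) = real J * norm v + norm v" by (simp add: algebra_simps)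
    ultimately have "r \<le> norm z" "norm z \<le> R" using d unfolding r_def R_def by linarith+
    then show ?thesis by (simp add: A_def indicator_def)
  qed simp
  have shift: "(\<integral>z. indicator (ball (s i *\<^sub>R v) r) z * incr v (x + z) \<partial>lborel)
      = (\<integral>z. indicator (ball 0 r) z * incr v (x + (s i *\<^sub>R v + z)) \<partial>lborel)" for i x
  proof -
    have "(\<integral>z. indicator (ball (s i *\<^sub>R v) r) z * incr v (x + z) \<partial>lborel)
        = (\<integral>z. indicator (ball (s i *\<^sub>R v) r) (s i *\<^sub>R v + z) * incr v (x + (s i *\<^sub>R v + z)) \<partial>lborel)"
      by (rule integral_lborel_translate[symmetric])
         (intro borel_measurable_times borel_measurable_indicator, auto)
    then show ?thesis by (simp add: indicator_def dist_norm)
  qed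
  have int2: "integrable lborel (\<lambda>z. indicator (ball 0 r) z * incr v (x + (s i *\<^sub>R v + z)))" for i x
    using int[of "ball 0 r" "x + s i *\<^sub>R v"] by (simp add: add.assoc)
  have telescope: "1 \<le> (\<Sum>i<2*J. incr v (x + (s i *\<^sub>R v + z)))"
    if x: "\<bar>x \<bullet> e\<bar> \<le> H" and z: "z \<in> ball 0 r" for x z
  proof -
    define g where "g i = u (x + (s i *\<^sub>R v + z))" for i
    have "s (Suc i) = s i + 1" for i by (simp add: s_def)
    then have "x + (s i *\<^sub>R v + z) + v = x + (s (Suc i) *\<^sub>R v + z)" for i
      by (simp add: scaleR_add_left)
    then have "incr v (x + (s i *\<^sub>R v + z)) = g (Suc i) - g i" for i
      by (simp only: incr_def g_def)
    then have "(\<Sum>i<2*J. incr v (x + (s i *\<^sub>R v + z))) = g (2 * J) - g 0"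
      by (simp add: sum_lessThan_telescope)
    moreover have ze: "\<bar>z \<bullet> e\<bar> \<le> r"
      using Cauchy_Schwarz_ineq2[of z e] z ne by simp
    moreover have ve: "v \<bullet> e \<le> norm v" using norm_cauchy_schwarz[of v e] ne by simp
    moreover have "g (2 * J) > 1 - 1 / 2"
      unfolding g_def
    proof (rule H1)
      have "s (2 * J) * (v \<bullet> e) = real J * (v \<bullet> e) + (v \<bullet> e) / 2" by (simp add: s_def algebra_simps)
      then show "H1 \<le> (x + (s (2 * J) *\<^sub>R v + z)) \<bullet> e"
        using J' x ze v r unfolding inner_add_left inner_scaleR_left L_def r_def by linarith
    qed
    moreover have "g 0 < - 1 + 1 / 2"
      unfolding g_def
    proof (rule H2)
      have "s 0 * (v \<bullet> e) = - (real J * (v \<bullet> e)) + (v \<bullet> e) / 2" by (simp add: s_def algebra_simps)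
      then show "(x + (s 0 *\<^sub>R v + z)) \<bullet> e \<le> - H2"
        using J' x ze ve v r unfolding inner_add_left inner_scaleR_left L_def r_def by linarith
    qed
    ultimately show ?thesis by linarith
  qed
  define V where "V = measure lborel (ball (0::'a) r)"
  have V: "0 < V" using r by (simp add: V_def)
  have Vint: "(\<integral>z. indicator (ball (0::'a) r) z \<partial>lborel) = V" by (simp add: V_def)
  show ?thesis
  proof (rule that[of R "V / (2 * real J)"])
    show "0 < R" using v0 \<open>0 < real J\<close> by (simp add: R_def)
    show "0 < V / (2 * real J)" using V \<open>0 < real J\<close> by simp
    fix x assume x: "\<bar>x \<bullet> e\<bar> \<le> H"
    let ?m = "\<integral>z. indicator A z * incr v (x + z) \<partial>lborel"
    have "V \<le> (\<integral>z. (\<Sum>i<2*J. indicator (ball 0 r) z * incr v (x + (s i *\<^sub>R v + z))) \<partial>lborel)"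
      unfolding Vint[symmetric]
    proof (rule integral_mono)
      show "integrable lborel (indicat_real (ball (0::'a) r))"
        using emeasure_bounded_finite[of "ball (0::'a) r"] by (simp add: integrable_indicator_iff)
      show "integrable lborel (\<lambda>z. \<Sum>i<2*J. indicator (ball 0 r) z * incr v (x + (s i *\<^sub>R v + z)))"
        by (intro Bochner_Integration.integrable_sum int2)
      show "indicator (ball 0 r) z \<le> (\<Sum>i<2*J. indicator (ball 0 r) z * incr v (x + (s i *\<^sub>R v + z)))" for z
        using telescope[OF x, of z] unfolding sum_distrib_left[symmetric] by (simp add: indicator_def)
    qed
    also have "\<dots> = (\<Sum>i<2*J. \<integral>z. indicator (ball 0 r) z * incr v (x + (s i *\<^sub>R v + z)) \<partial>lborel)"
      by (intro Bochner_Integration.integral_sum int2)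
    also have "\<dots> \<le> (\<Sum>i<2*J. ?m)"
    proof (rule sum_mono)
      fix i assume "i \<in> {..<2*J}"
      then show "(\<integral>z. indicator (ball 0 r) z * incr v (x + (s i *\<^sub>R v + z)) \<partial>lborel) \<le> ?m"
        unfolding shift[symmetric] using nonneg ball_sub[of i]
        by (intro integral_mono int bA Am mult_right_mono) auto
    qed
    also have "\<dots> = 2 * real J * ?m" by simp
    finally show "V / (2 * real J)
        \<le> (\<integral>z. indicator {z. norm v / 4 \<le> norm z \<and> norm z \<le> R} z * incr v (x + z) \<partial>lborel)"
      using \<open>0 < real J\<close> by (simp add: A_def r_def pos_divide_le_eq mult.commute)
  qed
qed

text \<open>
  If the increment \<open>w\<close> were less than \<open>\<epsilon>\<close> at \<open>x0\<close>, it would be so at the nearby touching point \<open>x\<close>. There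
  the difference of the two values of \<open>f\<close> is small by uniform continuity, so the equation makes the operator
  at \<open>x\<close> almost nonnegative; the mass bound makes it at most \<open>O(\<epsilon>) - c \<beta>\<close>.
\<close>

lemma strict_positivity_on_slab:
  assumes v: "0 < v \<bullet> e" and nonneg: "\<And>x. 0 \<le> incr v x"
  obtains c where "0 < c" "\<And>x. \<bar>x \<bullet> e\<bar> \<le> H \<Longrightarrow> c \<le> incr v x"
proof -
  have ne: "norm e = 1" using unit by (simp add: norm_eq_sqrt_inner)
  obtain R \<beta> where R: "0 < R" and \<beta>: "0 < \<beta>" and mass: "\<And>x. \<bar>x \<bullet> e\<bar> \<le> H + 1 \<Longrightarrow>
      \<beta> \<le> (\<integral>z. indicator {z. norm v / 4 \<le> norm z \<and> norm z \<le> R} z * incr v (x + z) \<partial>lborel)"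
    using increment_mass_lower_bound[OF v nonneg, where H="H + 1"] by blast
  obtain c where c: "0 < c" "\<And>z. z \<noteq> 0 \<Longrightarrow> norm z \<le> R \<Longrightarrow> c \<le> k z"
    using kernel_lower_bound[OF R] by blast
  define r where "r = norm v / 4"
  have r: "0 < r" using v by (auto simp: r_def)
  define M where "M = (1 + 1 / r\<^sup>2) * second_moment"
  have M: "0 \<le> M" using second_moment_nonneg by (simp add: M_def)
  define \<theta> where "\<theta> = C * (c * \<beta>)"
  have \<theta>: "0 < \<theta>" using C_pos c \<beta> by (simp add: \<theta>_def)
  have "uniformly_continuous_on {-1..1} f"
    using f_continuous by (intro compact_uniformly_continuous) auto
  then obtain d where d: "0 < d"
    "\<And>s t. s \<in> {-1..1} \<Longrightarrow> t \<in> {-1..1} \<Longrightarrow> dist t s < d \<Longrightarrow> dist (f t) (f s) < \<theta> / 2"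
    unfolding uniformly_continuous_on_def using half_gt_zero[OF \<theta>] by blast
  \<comment> \<open>Below \<open>d\<close> the two values of \<open>f\<close> differ by less than \<open>\<theta> / 2\<close>; the second bound keeps the other error terms at most \<open>\<theta> / 2\<close>.\<close>
  define \<epsilon> where "\<epsilon> = min (d / 2) (\<theta> / (2 * (C * M + \<bar>\<mu>\<bar> + 1)))"
  have den: "0 < C * M + \<bar>\<mu>\<bar> + 1" using C_pos M by (simp add: add_nonneg_pos)
  have \<epsilon>: "0 < \<epsilon>" "\<epsilon> < d" using d(1) \<theta> den by (auto simp: \<epsilon>_def)
  have "\<epsilon> * (2 * (C * M + \<bar>\<mu>\<bar> + 1)) \<le> \<theta>"
    using den by (simp add: \<epsilon>_def pos_le_divide_eq[symmetric])
  then have \<epsilon>2: "C * (\<epsilon> * M) + \<bar>\<mu>\<bar> * \<epsilon> \<le> \<theta> / 2"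
    using \<epsilon> by (simp add: algebra_simps)
  show ?thesis
  proof (rule that[OF \<epsilon>(1)], rule ccontr)
    fix x0 assume x0: "\<bar>x0 \<bullet> e\<bar> \<le> H" "\<not> \<epsilon> \<le> incr v x0"
    obtain x where x: "dist x0 x \<le> 1" "incr v x \<le> incr v x0"
      "incr_pv v x \<le> \<epsilon> * (1 + 1 / r\<^sup>2) * second_moment
        - c * (\<integral>z. indicator {z. r \<le> norm z \<and> norm z \<le> R} z * (incr v (x + z) - 0) \<partial>lborel)"
      using touching_increment[of 0 v x0 \<epsilon> r c R] nonneg x0 \<epsilon> r c by auto
    have "\<bar>(x - x0) \<bullet> e\<bar> \<le> 1"
      using Cauchy_Schwarz_ineq2[of "x - x0" e] x(1) ne by (simp add: dist_norm norm_minus_commute)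
    then have "\<bar>x \<bullet> e\<bar> \<le> H + 1" using x0 unfolding inner_diff_left by linarith
    from mass[OF this] have "c * \<beta> \<le> c * (\<integral>z. indicator {z. r \<le> norm z \<and> norm z \<le> R} z * (incr v (x + z) - 0) \<partial>lborel)"
      using c by (intro mult_left_mono) (auto simp: r_def)
    then have "incr_pv v x \<le> \<epsilon> * M - c * \<beta>" using x(3) by (simp add: M_def mult.assoc)
    then have "C * incr_pv v x \<le> C * (\<epsilon> * M - c * \<beta>)" using C_pos by (intro mult_left_mono) auto
    then have 1: "f (u (x + v)) - f (u x) - \<mu> * incr v x \<le> C * (\<epsilon> * M) - \<theta>"
      unfolding C_times_incr_pv by (simp add: \<theta>_def right_diff_distrib)
    have w: "0 \<le> incr v x" "incr v x < \<epsilon>" using nonneg x(2) x0(2) by auto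
    then have "dist (f (u (x + v))) (f (u x)) < \<theta> / 2"
      using u_bounded[of x] u_bounded[of "x + v"] \<epsilon>
      by (intro d(2)) (auto simp: dist_real_def incr_def abs_le_iff)
    moreover have "\<mu> * incr v x \<le> \<bar>\<mu>\<bar> * \<epsilon>" using w by (intro mult_mono) auto
    ultimately show False using 1 \<epsilon>2 \<theta> by (simp add: dist_real_def abs_less_iff)
  qed
qed

text \<open>
  Continuation in the length \<open>t\<close> of the translation: \<open>t v\<close> is admissible for large \<open>t\<close>, where it carries the
  region above the bottom of the central slab to above its top, and the set of admissible \<open>t\<close> can be continued
  down to \<open>0\<close>.
\<close>

lemma incr_nonneg_transversal:
  assumes v: "0 < v \<bullet> e"
  shows "0 \<le> incr v x"
proof -
  obtain H where H: "0 \<le> H" and order: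
    "\<And>v x. \<forall>x. incr v x < 0 \<longrightarrow> x \<bullet> e \<le> - H \<or> H \<le> (x + v) \<bullet> e \<Longrightarrow> 0 \<le> incr v x"
    using ordering_outside_core by blast
  define S where "S = {t. 0 \<le> t \<and> (\<forall>\<tau>\<ge>t. \<forall>x. 0 \<le> incr (\<tau> *\<^sub>R v) x)}"
  have "2 * H / (v \<bullet> e) \<in> S"
  proof -
    have "0 \<le> incr (\<tau> *\<^sub>R v) x" if "2 * H / (v \<bullet> e) \<le> \<tau>" for \<tau> x
    proof (rule order, intro allI impI)
      fix x
      have "2 * H \<le> \<tau> * (v \<bullet> e)" using that v by (simp add: pos_divide_le_eq)
      then show "x \<bullet> e \<le> - H \<or> H \<le> (x + \<tau> *\<^sub>R v) \<bullet> e" unfolding inner_add_left inner_scaleR_left by linarith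
    qed
    then show ?thesis using H v by (simp add: S_def)
  qed
  then have ne: "S \<noteq> {}" by auto
  have S_nonneg: "0 \<le> t" if "t \<in> S" for t using that unfolding S_def by blast
  then have bdd: "bdd_below S" by (rule bdd_belowI)
  define t0 where "t0 = Inf S"
  have t0: "0 \<le> t0" unfolding t0_def by (rule cInf_greatest[OF ne S_nonneg])
  have above: "0 \<le> incr (\<tau> *\<^sub>R v) x" if "t0 < \<tau>" for \<tau> x
  proof -
    have "\<exists>t\<in>S. t < \<tau>" using that unfolding t0_def by (rule cInf_lessD[OF ne])
    then obtain t where t: "t \<in> S" "t \<le> \<tau>" by (blast intro: less_imp_le)
    from t(1) have "\<forall>\<tau>\<ge>t. \<forall>x. 0 \<le> incr (\<tau> *\<^sub>R v) x" unfolding S_def by blast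
    with t(2) show ?thesis by blast
  qed
  have at_t0: "0 \<le> incr (t0 *\<^sub>R v) x" for x
  proof (rule tendsto_lowerbound)
    have "isCont u (x + t0 *\<^sub>R v)" using u_continuous by (simp add: continuous_on_eq_continuous_at)
    moreover have "((\<lambda>\<tau>. x + \<tau> *\<^sub>R v) \<longlongrightarrow> x + t0 *\<^sub>R v) (at_right t0)" by (intro tendsto_intros)
    ultimately have "((\<lambda>\<tau>. u (x + \<tau> *\<^sub>R v)) \<longlongrightarrow> u (x + t0 *\<^sub>R v)) (at_right t0)"
      by (rule isCont_tendsto_compose)
    then show "((\<lambda>\<tau>. incr (\<tau> *\<^sub>R v) x) \<longlongrightarrow> incr (t0 *\<^sub>R v) x) (at_right t0)"
      unfolding incr_def by (intro tendsto_intros)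
    show "\<forall>\<^sub>F \<tau> in at_right t0. 0 \<le> incr (\<tau> *\<^sub>R v) x"
      using eventually_at_right_less[of t0] by eventually_elim (rule above)
  qed simp
  have "t0 = 0"
  proof (rule ccontr)
    assume "t0 \<noteq> 0"
    then have pos: "0 < t0" using t0 by simp
    then have "0 < (t0 *\<^sub>R v) \<bullet> e" using v by simp
    then obtain c where c: "0 < c" "\<And>x. \<bar>x \<bullet> e\<bar> \<le> H \<Longrightarrow> c \<le> incr (t0 *\<^sub>R v) x"
      using strict_positivity_on_slab[OF _ at_t0, where H=H] by blast
    \<comment> \<open>A slab that contains \<open>x + \<tau> v\<close> for all \<open>x\<close> in the central slab and \<open>0 \<le> \<tau> \<le> t0\<close>.\<close>
    let ?T = "{x. \<bar>x \<bullet> e\<bar> \<le> H + t0 * (v \<bullet> e)}"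
    obtain d where d: "0 < d" "\<And>x y. x \<in> ?T \<Longrightarrow> y \<in> ?T \<Longrightarrow> dist y x < d \<Longrightarrow> dist (u y) (u x) < c"
      using u_uniformly_continuous[of "H + t0 * (v \<bullet> e)"] c(1) unfolding uniformly_continuous_on_def by blast
    have nv: "0 < norm v" using v by auto
    define \<eta> where "\<eta> = min t0 (d / (2 * norm v))"
    have \<eta>: "0 < \<eta>" "\<eta> \<le> t0" using pos d nv by (auto simp: \<eta>_def)
    have "\<eta> * norm v \<le> d / (2 * norm v) * norm v" by (intro mult_right_mono) (auto simp: \<eta>_def)
    then have \<eta>d: "\<eta> * norm v < d" using nv d(1) by simp
    have "0 \<le> incr (\<tau> *\<^sub>R v) y" if \<tau>: "t0 - \<eta> \<le> \<tau>" "\<tau> \<le> t0" for \<tau> y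
    proof (rule order, intro allI impI)
      fix x assume neg: "incr (\<tau> *\<^sub>R v) x < 0"
      have \<tau>0: "0 \<le> \<tau>" using \<tau> \<eta> by linarith
      have ve: "0 \<le> \<tau> * (v \<bullet> e)" "\<tau> * (v \<bullet> e) \<le> t0 * (v \<bullet> e)" "0 \<le> t0 * (v \<bullet> e)"
        using \<tau>0 \<tau> v pos by (auto intro: mult_right_mono)
      have "\<not> \<bar>x \<bullet> e\<bar> \<le> H"
      proof
        assume x: "\<bar>x \<bullet> e\<bar> \<le> H"
        have "dist (x + \<tau> *\<^sub>R v) (x + t0 *\<^sub>R v) = \<bar>\<tau> - t0\<bar> * norm v"
          by (simp add: dist_norm flip: scaleR_diff_left)
        also have "\<dots> \<le> \<eta> * norm v" using \<tau> by (intro mult_right_mono) auto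
        finally have "dist (x + \<tau> *\<^sub>R v) (x + t0 *\<^sub>R v) < d" using \<eta>d by linarith
        moreover have "x + \<tau> *\<^sub>R v \<in> ?T" "x + t0 *\<^sub>R v \<in> ?T"
          using x ve unfolding mem_Collect_eq inner_add_left inner_scaleR_left by linarith+
        ultimately have "dist (u (x + \<tau> *\<^sub>R v)) (u (x + t0 *\<^sub>R v)) < c" by (intro d(2))
        then show False using neg c(2)[OF x] by (simp add: incr_def dist_real_def)
      qed
      then show "x \<bullet> e \<le> - H \<or> H \<le> (x + \<tau> *\<^sub>R v) \<bullet> e"
        using ve unfolding inner_add_left inner_scaleR_left by linarith
    qed
    then have "0 \<le> incr (\<tau> *\<^sub>R v) y" if "t0 - \<eta> \<le> \<tau>" for \<tau> y
      using that above by (cases "\<tau> \<le> t0") auto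
    then have "t0 - \<eta> \<in> S" using \<eta> unfolding S_def by simp
    then have "t0 \<le> t0 - \<eta>" unfolding t0_def by (intro cInf_lower bdd)
    with \<eta> show False by linarith
  qed
  then show ?thesis using above[of 1 x] by simp
qed

lemma strictly_increasing:
  assumes "0 < v \<bullet> e"
  shows "u x < u (x + v)"
proof -
  obtain c where "0 < c" "c \<le> incr v x"
    using strict_positivity_on_slab[OF assms incr_nonneg_transversal[OF assms], where H="\<bar>x \<bullet> e\<bar>"] by blast
  then show ?thesis by (simp add: incr_def)
qed

text \<open>
  Tilt \<open>v\<close> slightly upwards and let the tilt tend to zero.
\<close>

lemma incr_nonneg_tangential:
  assumes "v \<bullet> e = 0"
  shows "u x \<le> u (x + v)"
proof (rule tendsto_lowerbound)
  have "isCont u (x + (v + 0 *\<^sub>R e))" using u_continuous by (simp add: continuous_on_eq_continuous_at)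
  moreover have "((\<lambda>t. x + (v + t *\<^sub>R e)) \<longlongrightarrow> x + (v + 0 *\<^sub>R e)) (at_right 0)" by (intro tendsto_intros)
  ultimately have "((\<lambda>t. u (x + (v + t *\<^sub>R e))) \<longlongrightarrow> u (x + (v + 0 *\<^sub>R e))) (at_right 0)"
    by (rule isCont_tendsto_compose)
  then show "((\<lambda>t. u (x + (v + t *\<^sub>R e))) \<longlongrightarrow> u (x + v)) (at_right 0)" by simp
  show "\<forall>\<^sub>F t in at_right 0. u x \<le> u (x + (v + t *\<^sub>R e))"
    using eventually_at_right_less[of 0]
  proof eventually_elim
    case (elim t)
    have "0 < (v + t *\<^sub>R e) \<bullet> e" using elim assms unit by (simp add: inner_add_left)
    then show ?case using strictly_increasing[of "v + t *\<^sub>R e" x] by simp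
  qed
qed simp

lemma constant_tangentially:
  assumes "x \<bullet> e = y \<bullet> e"
  shows "u x = u y"
  using incr_nonneg_tangential[of "y - x" x] incr_nonneg_tangential[of "x - y" y] assms
  by (simp add: inner_diff_left)

end

section \<open>The kernel of the relativistic operator\<close>

definition bessel_kernel :: "real \<Rightarrow> real \<Rightarrow> 'a::euclidean_space \<Rightarrow> real" where
  "bessel_kernel \<nu> m z = bessel_K \<nu> (m * norm z) / norm z powr \<nu>"

lemma bessel_kernel_measurable [measurable]: "bessel_kernel \<nu> m \<in> borel_measurable borel"
  unfolding bessel_kernel_def[abs_def] by measurable

lemma bessel_kernel_nonneg: "0 \<le> bessel_kernel \<nu> m z"
  by (simp add: bessel_kernel_def bessel_K_nonneg)

lemma bessel_kernel_le:
  assumes "0 \<le> \<nu>" "\<nu> < p" "0 < m" "z \<noteq> 0"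
  shows "bessel_kernel \<nu> m z \<le> (2 * p / m) powr p / (p - \<nu>) * norm z powr (- p - \<nu>)"
proof -
  have "bessel_kernel \<nu> m z \<le> (2 * p / (m * norm z)) powr p / (p - \<nu>) / norm z powr \<nu>"
    unfolding bessel_kernel_def using assms by (intro divide_right_mono bessel_K_le) auto
  also have "2 * p / (m * norm z) = (2 * p / m) / norm z" by simp
  also have "(\<dots>) powr p / (p - \<nu>) / norm z powr \<nu> = (2 * p / m) powr p / (p - \<nu>) * norm z powr (- p - \<nu>)"
    using assms by (simp add: powr_divide powr_mult powr_diff powr_minus divide_simps)
  finally show ?thesis .
qed

text \<open>
  With the bound of \<open>bessel_kernel_le\<close>, the integrand is at most a multiple of the power \<open>2 - p - \<nu>\<close> of the
  norm, for every \<open>p > \<nu>\<close>. Near the origin this power must exceed minus the dimension, which is possible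
  exactly because \<open>\<nu> < DIM('a) / 2 + 1\<close> (for \<open>\<nu> = N/2 + s\<close> this is \<open>s < 1\<close>); at infinity any large
  \<open>p\<close> serves.
\<close>

lemma integrable_bessel_kernel_second_moment:
  assumes "0 \<le> \<nu>" "\<nu> < real DIM('a) / 2 + 1" "0 < m"
  shows "integrable lborel (\<lambda>z::'a::euclidean_space. (norm z)\<^sup>2 * bessel_kernel \<nu> m z)"
proof (rule Bochner_Integration.integrable_bound)
  let ?N = "real DIM('a)"
  define p1 where "p1 = ?N / 2 + 1"
  define p2 where "p2 = \<nu> + ?N + 3"
  define c where "c p = (2 * p / m) powr p / (p - \<nu>)" for p
  have c: "c p1 \<ge> 0" "c p2 \<ge> 0" using assms by (auto simp: c_def p1_def p2_def)
  let ?G = "\<lambda>z::'a. c p1 * (indicator (ball 0 1) z * norm z powr (2 - p1 - \<nu>))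
      + c p2 * (indicator (- ball 0 1) z * norm z powr (2 - p2 - \<nu>))"
  show "integrable lborel ?G"
    using assms by (intro Bochner_Integration.integrable_add integrable_mult_right integrable_norm_powr_near
        integrable_norm_powr_far) (auto simp: p1_def p2_def)
  have sq: "(norm z)\<^sup>2 * bessel_kernel \<nu> m z \<le> c p * norm z powr (2 - p - \<nu>)" if "\<nu> < p" "z \<noteq> 0" for p and z :: 'a
  proof -
    have "(norm z)\<^sup>2 * bessel_kernel \<nu> m z \<le> (norm z)\<^sup>2 * (c p * norm z powr (- p - \<nu>))"
      unfolding c_def using assms that by (intro mult_left_mono bessel_kernel_le) auto
    also have "(norm z)\<^sup>2 = norm z powr 2" using that by (simp add: powr_numeral)
    also have "\<dots> * (c p * norm z powr (- p - \<nu>)) = c p * (norm z powr 2 * norm z powr (- p - \<nu>))"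
      by (simp add: mult_ac)
    also have "norm z powr 2 * norm z powr (- p - \<nu>) = norm z powr (2 - p - \<nu>)"
      by (subst powr_add[symmetric]) (simp add: algebra_simps)
    finally show ?thesis using that by (simp add: powr_numeral)
  qed
  have "(norm z)\<^sup>2 * bessel_kernel \<nu> m z \<le> ?G z" for z :: 'a
    using sq[of p1 z] sq[of p2 z] assms by (cases "z = 0") (auto simp: indicator_def p1_def p2_def)
  then show "AE z::'a in lborel. norm ((norm z)\<^sup>2 * bessel_kernel \<nu> m z) \<le> norm (?G z)"
    using c by (intro AE_I2) (simp add: bessel_kernel_nonneg)
qed auto

text \<open>
  The kernel is radially decreasing, so its value at radius \<open>R\<close> is a lower bound.
\<close>

lemma bessel_kernel_lower_bound:
  assumes "0 \<le> \<nu>" "0 < m" "0 < R"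
  shows "\<exists>\<kappa>>0. \<forall>z::'a::euclidean_space. z \<noteq> 0 \<longrightarrow> norm z \<le> R \<longrightarrow> \<kappa> \<le> bessel_kernel \<nu> m z"
proof (intro exI[of _ "bessel_K \<nu> (m * R) / R powr \<nu>"] conjI allI impI)
  show "0 < bessel_K \<nu> (m * R) / R powr \<nu>" using assms by (simp add: bessel_K_pos)
  show "bessel_K \<nu> (m * R) / R powr \<nu> \<le> bessel_kernel \<nu> m z" if "z \<noteq> 0" "norm z \<le> R" for z :: 'a
    unfolding bessel_kernel_def using assms that
    by (intro frac_le bessel_K_nonneg bessel_K_antimono powr_mono2) auto
qed

lemma levy_kernel_bessel_kernel:
  assumes "0 \<le> \<nu>" "\<nu> < real DIM('a) / 2 + 1" "0 < m"
  shows "levy_kernel (bessel_kernel \<nu> m :: 'a::euclidean_space \<Rightarrow> real)"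
proof
  show "bessel_kernel \<nu> m (- z) = bessel_kernel \<nu> m z" for z :: 'a by (simp add: bessel_kernel_def)
qed (use assms in \<open>auto intro!: bessel_kernel_nonneg integrable_bessel_kernel_second_moment
       bessel_kernel_lower_bound\<close>)

lemma c_const_pos: "0 < s \<Longrightarrow> s < 1 \<Longrightarrow> 0 < c_const N s"
  by (simp add: c_const_def Gamma_real_pos)

section \<open>The function spaces and the conditions at infinity\<close>

lemma C11_loc_continuous: "u \<in> C11_loc \<Longrightarrow> continuous_on UNIV u"
  unfolding C11_loc_def gderiv_def
  by (auto simp: continuous_on_eq_continuous_at intro: has_derivative_continuous)

lemma holder_space_bound:
  assumes "u \<in> holder_space \<alpha> S"
  obtains C where "0 < C" "\<And>x y. x \<in> S \<Longrightarrow> y \<in> S \<Longrightarrow> \<bar>u x - u y\<bar> \<le> C * dist x y powr \<alpha>"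
proof -
  obtain C where C: "holder_norm \<alpha> S u \<le> ennreal C" using assms by (auto simp: holder_space_def)
  have "\<bar>u x - u y\<bar> \<le> (max C 0 + 1) * dist x y powr \<alpha>" if xy: "x \<in> S" "y \<in> S" for x y
  proof (cases "x = y")
    case False
    let ?P = "{(x, y). x \<in> S \<and> y \<in> S \<and> x \<noteq> y}"
    have "ennreal (\<bar>u x - u y\<bar> / dist x y powr \<alpha>)
        \<le> (SUP (x, y)\<in>?P. ennreal (\<bar>u x - u y\<bar> / dist x y powr \<alpha>))"
      using xy False by (intro SUP_upper2[of "(x, y)"]) auto
    also have "\<dots> \<le> holder_norm \<alpha> S u" unfolding holder_norm_def by (intro add_increasing order_refl) simp
    also have "\<dots> \<le> ennreal C" by (rule C)
    also have "\<dots> \<le> ennreal (max C 0 + 1)" by (intro ennreal_leI) auto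
    finally have "\<bar>u x - u y\<bar> / dist x y powr \<alpha> \<le> max C 0 + 1" by (subst (asm) ennreal_le_iff) auto
    then show ?thesis using False by (simp add: pos_divide_le_eq)
  qed simp
  then show ?thesis by (intro that[of "max C 0 + 1"]) auto
qed

lemma holder_space_uniformly_continuous:
  assumes "u \<in> holder_space \<alpha> S" "0 < \<alpha>"
  shows "uniformly_continuous_on S u"
proof -
  obtain C where C: "0 < C" "\<And>x y. x \<in> S \<Longrightarrow> y \<in> S \<Longrightarrow> \<bar>u x - u y\<bar> \<le> C * dist x y powr \<alpha>"
    using assms(1) by (rule holder_space_bound) blast
  show ?thesis
    unfolding uniformly_continuous_on_def
  proof (intro allI impI)
    fix \<epsilon> :: real assume "0 < \<epsilon>"
    define d where "d = (\<epsilon> / C) powr (1 / \<alpha>)"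
    have "dist (u y) (u x) < \<epsilon>" if "x \<in> S" "y \<in> S" "dist y x < d" for x y
    proof -
      have "dist y x powr \<alpha> < d powr \<alpha>" using that(3) assms(2) by (intro powr_less_mono2) auto
      also have "d powr \<alpha> = \<epsilon> / C" using assms(2) C(1) \<open>0 < \<epsilon>\<close> by (simp add: d_def powr_powr)
      finally have "C * dist y x powr \<alpha> < \<epsilon>" using C(1) by (simp add: pos_less_divide_eq mult.commute)
      then show ?thesis using C(2)[OF that(2,1)] by (simp add: dist_real_def)
    qed
    moreover have "0 < d" using C(1) \<open>0 < \<epsilon>\<close> by (simp add: d_def)
    ultimately show "\<exists>d>0. \<forall>x\<in>S. \<forall>x'\<in>S. dist x' x < d \<longrightarrow> dist (u x') (u x) < \<epsilon>" by blast
  qed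
qed

lemma uniform_limit_along_axis:
  fixes u :: "real ^ 'n \<Rightarrow> real"
  assumes "uniform_limit {x'. x' $ k = 0} (\<lambda>t x'. u (x' + t *\<^sub>R axis k 1)) (\<lambda>_. l) F" "0 < \<eta>"
  shows "\<forall>\<^sub>F t in F. \<forall>x. x $ k = t \<longrightarrow> \<bar>u x - l\<bar> < \<eta>"
proof -
  have "\<forall>\<^sub>F t in F. \<forall>x'\<in>{x'. x' $ k = 0}. dist (u (x' + t *\<^sub>R axis k 1)) l < \<eta>"
    using assms unfolding uniform_limit_iff by blast
  then show ?thesis
  proof eventually_elim
    case (elim t)
    show ?case
    proof (intro allI impI)
      fix x :: "real ^ 'n" assume "x $ k = t"
      then have "dist (u ((x - t *\<^sub>R axis k 1) + t *\<^sub>R axis k 1)) l < \<eta>"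
        by (intro bspec[OF elim]) (simp add: axis_def)
      then show "\<bar>u x - l\<bar> < \<eta>" by (simp add: dist_real_def)
    qed
  qed
qed

section \<open>Monotonicity and one-dimensional symmetry\<close>

theorem theorem3p14:
  fixes u :: "real ^ 'n \<Rightarrow> real" and f :: "real \<Rightarrow> real"
    and m s \<alpha> :: real and k :: 'n
  assumes "0 < s" "s < 1" and "0 < m" and "0 < \<alpha>" "\<alpha> \<le> 1"
    and "u \<in> L_space s \<inter> C11_loc \<inter> (\<Inter>H\<in>{0<..}. holder_space \<alpha> (slab k H))"
    and "\<And>x. has_rel_laplacian m s u (f (u x)) x"
    and "\<And>x. \<bar>u x\<bar> \<le> 1"
    and "uniform_limit {x'. x' $ k = 0} (\<lambda>t x'. u (x' + t *\<^sub>R axis k 1)) (\<lambda>_. 1) at_top"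
    and "uniform_limit {x'. x' $ k = 0} (\<lambda>t x'. u (x' + t *\<^sub>R axis k 1)) (\<lambda>_. - 1) at_bot"
    and "continuous_on {-1..1} f"
    and "\<exists>\<delta>>0. (SUP (t1, t2)\<in>{(t1, t2). (-1 \<le> t1 \<and> t1 < t2 \<and> t2 \<le> -1 + \<delta>) \<or>
                                          (1 - \<delta> \<le> t1 \<and> t1 < t2 \<and> t2 \<le> 1)}.
                  ereal ((f t2 - f t1) / (t2 - t1))) < ereal (m powr (2 * s))"
  shows "(\<forall>x'. x' $ k = 0 \<longrightarrow> strict_mono (\<lambda>t. u (x' + t *\<^sub>R axis k 1))) \<and>
         (\<exists>v. \<forall>x. u x = v (x $ k))"
proof -
  define \<nu> where "\<nu> = real CARD('n) / 2 + s"
  define C where "C = c_const (real CARD('n)) s * m powr \<nu>"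
  define e :: "real ^ 'n" where "e = axis k 1"
  define K :: "real ^ 'n \<Rightarrow> real" where "K = bessel_kernel \<nu> m"
  have inner_e: "x \<bullet> e = x $ k" for x by (simp add: e_def inner_axis)
  obtain \<delta> where \<delta>: "0 < \<delta>" and sup: "(SUP (t1, t2)\<in>{(t1, t2). (-1 \<le> t1 \<and> t1 < t2 \<and> t2 \<le> -1 + \<delta>) \<or>
      (1 - \<delta> \<le> t1 \<and> t1 < t2 \<and> t2 \<le> 1)}. ereal ((f t2 - f t1) / (t2 - t1))) < ereal (m powr (2 * s))"
    (is "Sup (?g ` ?P) < _")
    using assms(12) by blast
  obtain \<kappa> where \<kappa>: "Sup (?g ` ?P) < ereal \<kappa>" "\<kappa> < m powr (2 * s)"
    using ereal_dense2[OF sup] by auto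
  interpret levy_kernel K
    unfolding K_def using assms(1-3) by (intro levy_kernel_bessel_kernel) (auto simp: \<nu>_def)
  have cont: "continuous_on UNIV u" using assms(6) by (intro C11_loc_continuous) blast
  interpret sliding_problem K u f e C "m powr (2 * s)" \<kappa> \<delta>
  proof
    show "0 < C" using assms(1-3) by (simp add: C_def c_const_pos)
    show "continuous_on UNIV u" by (rule cont)
    show "\<bar>u x\<bar> \<le> 1" for x by (rule assms(8))
    show "\<exists>I. pv u x I \<and> f (u x) = C * I + m powr (2 * s) * u x" for x
    proof -
      obtain I where I: "has_pv_integral (\<lambda>y. (u x - u y) / norm (x - y) powr \<nu> * bessel_K \<nu> (m * norm (x - y))) I x"
        "f (u x) = C * I + m powr (2 * s) * u x"
        using assms(7)[of x] unfolding has_rel_laplacian_def Let_def C_def \<nu>_def by blast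
      have "(\<lambda>y. (u x - u y) / norm (x - y) powr \<nu> * bessel_K \<nu> (m * norm (x - y)))
          = (\<lambda>y. (u x - u y) * K (x - y))"
        by (simp add: K_def bessel_kernel_def)
      then have "pv u x I"
        using I(1) cont unfolding has_pv_integral_def
        by (intro pv_of_has_pv_integral borel_measurable_continuous_onI) simp_all
      with I(2) show ?thesis by blast
    qed
    show "e \<bullet> e = 1" by (simp add: inner_e) (simp add: e_def)
    show "uniformly_continuous_on {x. \<bar>x \<bullet> e\<bar> \<le> H} u" for H
    proof -
      have "u \<in> holder_space \<alpha> (slab k (\<bar>H\<bar> + 1))" using assms(6) by auto
      then have "uniformly_continuous_on (slab k (\<bar>H\<bar> + 1)) u"
        using assms(4) by (rule holder_space_uniformly_continuous)
      moreover have "{x. \<bar>x \<bullet> e\<bar> \<le> H} \<subseteq> slab k (\<bar>H\<bar> + 1)" by (auto simp: slab_def inner_e)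
      ultimately show ?thesis unfolding uniformly_continuous_on_def by (meson subsetD)
    qed
    show "\<exists>H. \<forall>x. H \<le> x \<bullet> e \<longrightarrow> 1 - \<eta> < u x" if \<eta>: "0 < \<eta>" for \<eta>
      using uniform_limit_along_axis[OF assms(9) \<eta>] unfolding eventually_at_top_linorder inner_e
      by (smt (verit))
    show "\<exists>H. \<forall>x. x \<bullet> e \<le> - H \<longrightarrow> u x < - 1 + \<eta>" if \<eta>: "0 < \<eta>" for \<eta>
    proof -
      obtain b where "\<forall>t\<le>b. \<forall>x. x $ k = t \<longrightarrow> \<bar>u x - - 1\<bar> < \<eta>"
        using uniform_limit_along_axis[OF assms(10) \<eta>] unfolding eventually_at_bot_linorder by blast
      then have "\<bar>u x - - 1\<bar> < \<eta>" if "x $ k \<le> b" for x using that by blast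
      then show ?thesis unfolding inner_e by (intro exI[of _ "- b"]) (force simp: abs_less_iff)
    qed
    show "continuous_on {-1..1} f" by (rule assms(11))
    show "0 < \<delta>" "\<kappa> < m powr (2 * s)" by fact+
    show "f t2 - f t1 \<le> \<kappa> * (t2 - t1)"
      if "t1 < t2" "- 1 \<le> t1 \<and> t2 \<le> - 1 + \<delta> \<or> 1 - \<delta> \<le> t1 \<and> t2 \<le> 1" for t1 t2
    proof -
      have "?g (t1, t2) \<le> Sup (?g ` ?P)" using that by (intro SUP_upper) auto
      then have "?g (t1, t2) < ereal \<kappa>" using \<kappa>(1) by (rule order.strict_trans1)
      then show ?thesis using that(1) by (simp add: pos_divide_less_eq)
    qed
  qed
  show ?thesis
  proof (intro conjI allI impI strict_monoI exI[of _ "\<lambda>t. u (t *\<^sub>R e)"])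
    fix x' :: "real ^ 'n" and t t' :: real assume "t < t'"
    then have "0 < ((t' - t) *\<^sub>R e) \<bullet> e" by (simp add: unit)
    from strictly_increasing[OF this, of "x' + t *\<^sub>R e"]
    show "u (x' + t *\<^sub>R axis k 1) < u (x' + t' *\<^sub>R axis k 1)"
      by (simp add: e_def scaleR_diff_left)
  next
    fix x :: "real ^ 'n"
    show "u x = u (x $ k *\<^sub>R e)"
      by (rule constant_tangentially) (simp add: unit inner_e[of x])
  qed
qed

end
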